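(* Let $(R,\mathfrak{m})$ be a quasi-unmixed local ring and $I$ an equimultiple ideal of $R$. If the associated graded ring $G_I(R)$ satisfies Serre's condition $S_1$, then so does $G_{I^{m}}(R)$ for all integers $m\geq 1$.
   Context: Rings are commutative and Noetherian. A local ring $(R,\mathfrak m)$ is quasi-unmixed if its completion is equidimensional. The analytic spread of a proper ideal $I$ is $s(I)=\dim\bigoplus_{n\ge0}I^n/\mathfrak mI^n$, and $I$ is equimultiple if $\mathrm{ht}(I)=s(I)$. For an ideal $J$, $G_J(R)=\bigoplus_{n\ge0}J^n/J^{n+1}$. *)

theory Defs
  imports "HOL-Algebra.Algebra" "HOL-Library.Extended_Nat"
begin

section \<open>Krull dimension, height, equidimensionality\<close>

definition prime_chain :: "('a, 'b) ring_scheme \<Rightarrow> nat \<Rightarrow> (nat \<Rightarrow> 'a set) \<Rightarrow> bool" where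
  "prime_chain R n P \<longleftrightarrow> (\<forall>i\<le>n. primeideal (P i) R) \<and> (\<forall>i<n. P i \<subset> P (Suc i))"

text \<open>The value \<open>0\<close> for the zero ring (empty supremum) is a convention; below the dimension is
  only taken of nonzero rings.\<close>

definition krull_dim :: "('a, 'b) ring_scheme \<Rightarrow> enat" where
  "krull_dim R = Sup {enat n |n. \<exists>P. prime_chain R n P}"

definition prime_height :: "('a, 'b) ring_scheme \<Rightarrow> 'a set \<Rightarrow> enat" where
  "prime_height R Q = Sup {enat n |n. \<exists>P. prime_chain R n P \<and> P n = Q}"

definition ideal_height :: "('a, 'b) ring_scheme \<Rightarrow> 'a set \<Rightarrow> enat" where
  "ideal_height R I = Inf {prime_height R Q |Q. primeideal Q R \<and> I \<subseteq> Q}"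

definition minimal_prime :: "('a, 'b) ring_scheme \<Rightarrow> 'a set \<Rightarrow> bool" where
  "minimal_prime R P \<longleftrightarrow> primeideal P R \<and> (\<forall>Q. primeideal Q R \<and> Q \<subseteq> P \<longrightarrow> Q = P)"

definition equidimensional :: "('a, 'b) ring_scheme \<Rightarrow> bool" where
  "equidimensional R \<longleftrightarrow> (\<forall>P. minimal_prime R P \<longrightarrow> krull_dim (R Quot P) = krull_dim R)"

section \<open>Local rings, completion, quasi-unmixedness\<close>

definition noetherian_local_ring :: "('a, 'b) ring_scheme \<Rightarrow> 'a set \<Rightarrow> bool" where
  "noetherian_local_ring R M \<longleftrightarrow>
     cring R \<and> noetherian_ring R \<and> maximalideal M R \<and> (\<forall>N. maximalideal N R \<longrightarrow> N = M)"

text \<open>Multiplication in the library structure \<open>ideals_set R\<close> is the ideal product, with unit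
  \<open>carrier R\<close>; hence its monoid powers are the ideal powers and the zeroth power is \<open>R\<close>.\<close>

definition ideal_pow :: "('a, 'b) ring_scheme \<Rightarrow> 'a set \<Rightarrow> nat \<Rightarrow> 'a set" where
  "ideal_pow R J n = J [^]\<^bsub>ideals_set R\<^esub> n"

text \<open>The inverse limit of the rings \<open>R / M^n\<close>.  The transition map sends a coset of
  \<open>M^(n+1)\<close> to the unique coset of \<open>M^n\<close> containing it, so compatibility is inclusion.\<close>

definition completion :: "('a, 'b) ring_scheme \<Rightarrow> 'a set \<Rightarrow> (nat \<Rightarrow> 'a set) ring" where
  "completion R M =
     \<lparr>carrier = {f. \<forall>n. f n \<in> carrier (R Quot ideal_pow R M n) \<and> f (Suc n) \<subseteq> f n},
      monoid.mult = (\<lambda>f g n. f n \<otimes>\<^bsub>R Quot ideal_pow R M n\<^esub> g n),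
      one = (\<lambda>n. \<one>\<^bsub>R Quot ideal_pow R M n\<^esub>),
      ring.zero = (\<lambda>n. \<zero>\<^bsub>R Quot ideal_pow R M n\<^esub>),
      add = (\<lambda>f g n. f n \<oplus>\<^bsub>R Quot ideal_pow R M n\<^esub> g n)\<rparr>"

definition quasi_unmixed :: "('a, 'b) ring_scheme \<Rightarrow> 'a set \<Rightarrow> bool" where
  "quasi_unmixed R M \<longleftrightarrow> equidimensional (completion R M)"

section \<open>Graded rings attached to an ideal\<close>

text \<open>The ring \<open>\<Oplus>n. F n / F' n\<close> for ideals \<open>F' n \<subseteq> F n\<close> with \<open>F 0 = R\<close>,
  \<open>F i F j \<subseteq> F (i + j)\<close> and \<open>F i F' j \<subseteq> F' (i + j)\<close>.  Its elements are the finitely supported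
  families of cosets.  The product of \<open>a + F' i\<close> and \<open>b + F' j\<close> is \<open>a b + F' (i + j)\<close>, which is
  what \<open>rcoset_mult\<close> yields when used with the ideal \<open>F' (i + j)\<close>; the sum over
  \<open>i + j = n\<close> is formed in \<open>R / F' n\<close>.\<close>

definition graded_quotient ::
    "('a, 'b) ring_scheme \<Rightarrow> (nat \<Rightarrow> 'a set) \<Rightarrow> (nat \<Rightarrow> 'a set) \<Rightarrow> (nat \<Rightarrow> 'a set) ring" where
  "graded_quotient R F F' =
     \<lparr>carrier = {f. (\<forall>n. \<exists>a\<in>F n. f n = F' n +>\<^bsub>R\<^esub> a) \<and> finite {n. f n \<noteq> F' n}},
      monoid.mult = (\<lambda>f g n. finsum (R Quot F' n) (\<lambda>i. rcoset_mult R (F' n) (f i) (g (n - i))) {..n}),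
      one = (\<lambda>n. if n = 0 then F' 0 +>\<^bsub>R\<^esub> \<one>\<^bsub>R\<^esub> else F' n),
      ring.zero = F',
      add = (\<lambda>f g n. f n <+>\<^bsub>R\<^esub> g n)\<rparr>"

definition assoc_graded :: "('a, 'b) ring_scheme \<Rightarrow> 'a set \<Rightarrow> (nat \<Rightarrow> 'a set) ring" where
  "assoc_graded R J = graded_quotient R (ideal_pow R J) (\<lambda>n. ideal_pow R J (Suc n))"

definition fiber_cone :: "('a, 'b) ring_scheme \<Rightarrow> 'a set \<Rightarrow> 'a set \<Rightarrow> (nat \<Rightarrow> 'a set) ring" where
  "fiber_cone R M I =
     graded_quotient R (ideal_pow R I) (\<lambda>n. ideal_prod R M (ideal_pow R I n))"

definition analytic_spread :: "('a, 'b) ring_scheme \<Rightarrow> 'a set \<Rightarrow> 'a set \<Rightarrow> enat" where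
  "analytic_spread R M I = krull_dim (fiber_cone R M I)"

definition equimultiple :: "('a, 'b) ring_scheme \<Rightarrow> 'a set \<Rightarrow> 'a set \<Rightarrow> bool" where
  "equimultiple R M I \<longleftrightarrow>
     ideal I R \<and> I \<noteq> carrier R \<and> ideal_height R I = analytic_spread R M I"

section \<open>Localization at a prime, depth, Serre's conditions\<close>

definition fraction :: "('a, 'b) ring_scheme \<Rightarrow> 'a set \<Rightarrow> 'a \<Rightarrow> 'a \<Rightarrow> ('a \<times> 'a) set" where
  "fraction R P a s =
     {(b, t). b \<in> carrier R \<and> t \<in> carrier R - P \<and>
        (\<exists>u\<in>carrier R - P. u \<otimes>\<^bsub>R\<^esub> (a \<otimes>\<^bsub>R\<^esub> t) = u \<otimes>\<^bsub>R\<^esub> (b \<otimes>\<^bsub>R\<^esub> s))}"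

text \<open>The operations are taken on all representatives; the union is over copies of a single
  equivalence class.\<close>

definition localization :: "('a, 'b) ring_scheme \<Rightarrow> 'a set \<Rightarrow> ('a \<times> 'a) set ring" where
  "localization R P =
     \<lparr>carrier = {fraction R P a s |a s. a \<in> carrier R \<and> s \<in> carrier R - P},
      monoid.mult = (\<lambda>A B. \<Union>{fraction R P (a \<otimes>\<^bsub>R\<^esub> b) (s \<otimes>\<^bsub>R\<^esub> t) |a s b t. (a, s) \<in> A \<and> (b, t) \<in> B}),
      one = fraction R P \<one>\<^bsub>R\<^esub> \<one>\<^bsub>R\<^esub>,
      ring.zero = fraction R P \<zero>\<^bsub>R\<^esub> \<one>\<^bsub>R\<^esub>,
      add = (\<lambda>A B. \<Union>{fraction R P (a \<otimes>\<^bsub>R\<^esub> t \<oplus>\<^bsub>R\<^esub> b \<otimes>\<^bsub>R\<^esub> s) (s \<otimes>\<^bsub>R\<^esub> t) |a s b t.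
               (a, s) \<in> A \<and> (b, t) \<in> B})\<rparr>"

definition localization_maximal :: "('a, 'b) ring_scheme \<Rightarrow> 'a set \<Rightarrow> ('a \<times> 'a) set set" where
  "localization_maximal R P = {fraction R P a s |a s. a \<in> P \<and> s \<in> carrier R - P}"

definition regular_sequence :: "('a, 'b) ring_scheme \<Rightarrow> 'a list \<Rightarrow> bool" where
  "regular_sequence R xs \<longleftrightarrow>
     set xs \<subseteq> carrier R \<and> genideal R (set xs) \<noteq> carrier R \<and>
     (\<forall>i<length xs. \<forall>a\<in>carrier R.
        (xs ! i) \<otimes>\<^bsub>R\<^esub> a \<in> genideal R (set (take i xs)) \<longrightarrow> a \<in> genideal R (set (take i xs)))"

text \<open>The grade of \<open>N\<close> on \<open>R\<close>; it is the depth of \<open>R\<close> when \<open>R\<close> is a Noetherian local ring with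
  maximal ideal \<open>N\<close>.\<close>

definition depth :: "('a, 'b) ring_scheme \<Rightarrow> 'a set \<Rightarrow> enat" where
  "depth R N = Sup {enat (length xs) |xs. regular_sequence R xs \<and> set xs \<subseteq> N}"

definition serre_condition :: "nat \<Rightarrow> ('a, 'b) ring_scheme \<Rightarrow> bool" where
  "serre_condition k R \<longleftrightarrow>
     (\<forall>P. primeideal P R \<longrightarrow>
        min (enat k) (krull_dim (localization R P))
          \<le> depth (localization R P) (localization_maximal R P))"

end

theory Submission
  imports Defs
begin

text \<open>
  For a Noetherian ring \<open>S\<^sub>1\<close>
  says that every zero divisor lies in a minimal prime.  Write \<open>G = G\<^sub>I(R)\<close> and \<open>B\<close> for the associated
  graded ring of \<open>I\<^sup>m\<close>.  A zero divisor of \<open>B\<close> is killed by a nonzero homogeneous element, the class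
  of some \<open>y\<close>; let \<open>y*\<close> be the initial form of \<open>y\<close> in \<open>G\<close>, and let \<open>Q\<close> be an associated prime of \<open>G\<close>
  containing the annihilator of \<open>y*\<close>.  It is minimal by hypothesis, and its preimage \<open>q\<close> under
  \<open>B \<rightarrow> G\<close>, \<open>I^(mn)/I^(mn+m) \<rightarrow> I^(mn)/I^(mn+1)\<close>, contains the given zero divisor.
  Finally \<open>q\<close> is minimal: if \<open>x\<close> represents a form in \<open>q\<close>, then some
  \<open>z* \<notin> Q\<close> kills a power \<open>x*\<^sup>k\<close>, that is, \<open>z x\<^sup>k\<close> gains one order in the \<open>I\<close>-adic filtration; then
  \<open>(z x\<^sup>k)\<^sup>m\<close> gains \<open>m\<close> orders, so it vanishes in \<open>B\<close>, and every prime contained in \<open>q\<close> contains the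
  class of \<open>x\<close>.
\<close>

section \<open>Primes of Noetherian rings\<close>

text \<open>The prime \<open>Q\<close> arises as the annihilator of an element that may be
  inhomogeneous, and its homogeneity is never established. So \<open>q\<close> is built from the
  forms of the preimage of \<open>Q\<close> alone: it is homogeneous by construction, and its
  primality can be tested degree by degree. This is also why the element that kills a zero divisor
  of \<open>B\<close> is first made homogeneous: then each component of the zero divisor kills it
  separately. If \<open>y\<close> has nonzero class in degree k of \<open>B\<close>, it lies outside
  I^(m(k+1)), so it has an order e with mk <= e < m(k+1). An x in I^(mn) with x y in I^(m(n+k+1))
  thus satisfies x y in I^(mn+e+1), which says that the form of x kills y*. The m-th power in the
  minimality argument acts twice: a gain of one order becomes the gain of m orders that vanishing in
  \<open>B\<close> means, and the form z* moves to a degree divisible by m, where \<open>B\<close>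
  can see it. To pass from zero divisors back to S_1, a non-minimal prime of \<open>B\<close> must
  contain an element outside all minimal primes. Prime avoidance gives it once there are finitely
  many of them, so \<open>B\<close> has to be Noetherian; this is the purpose of the basis
  theorem.\<close>

lemma (in noetherian_ring) exists_maximal_ideal:
  assumes "P I0" and "\<And>I. P I \<Longrightarrow> ideal I R"
  shows "\<exists>J. P J \<and> (\<forall>K. P K \<longrightarrow> J \<subseteq> K \<longrightarrow> K = J)"
proof -
  have "\<exists>J\<in>Collect P. \<forall>K\<in>Collect P. J \<subseteq> K \<longrightarrow> K = J"
  proof (rule subset_Zorn)
    fix C assume C: "subset.chain (Collect P) C"
    show "\<exists>U\<in>Collect P. \<forall>K\<in>C. K \<subseteq> U"
    proof (cases "C = {}")
      case True
      then show ?thesis using assms(1) by auto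
    next
      case False
      have CP: "C \<subseteq> Collect P" using C by (auto simp: pred_on.chain_def)
      \<comment> \<open>In a Noetherian ring a nonempty chain of ideals contains its own union, so
        the upper bound for Zorn's lemma stays in the family, whatever \<open>P\<close> is.\<close>
      have "subset.chain {I. ideal I R} C"
        using C assms(2) unfolding pred_on.chain_def by blast
      then have "\<Union>C \<in> C" using ideal_chain_is_trivial False by simp
      then show ?thesis using CP by blast
    qed
  qed
  then show ?thesis by simp
qed

text \<open>Ascending sequences are the form in which the property passes to quotients and to
  adjoined elements. For the converse, stability makes reverse inclusion well-founded; a minimal
  element of a chain for that order contains all other members and is therefore the union.\<close>

lemma (in ring) noetherian_iff_stable:
  "noetherian_ring R \<longleftrightarrow>
    (\<forall>\<aa> :: nat \<Rightarrow> 'a set. (\<forall>k. ideal (\<aa> k) R \<and> \<aa> k \<subseteq> \<aa> (Suc k)) \<longrightarrow> (\<exists>K. \<forall>k\<ge>K. \<aa> k = \<aa> K))"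
    (is "_ \<longleftrightarrow> ?stable")
proof
  assume "noetherian_ring R"
  then interpret noetherian_ring R .
  show ?stable
  proof (intro allI impI)
    fix \<aa> :: "nat \<Rightarrow> 'a set"
    assume \<aa>: "\<forall>k. ideal (\<aa> k) R \<and> \<aa> k \<subseteq> \<aa> (Suc k)"
    have "ideal J R" if "J \<in> range \<aa>" for J using that \<aa> by blast
    from exists_maximal_ideal[of "\<lambda>J. J \<in> range \<aa>", OF rangeI this]
    obtain J where J: "J \<in> range \<aa> \<and> (\<forall>K. K \<in> range \<aa> \<longrightarrow> J \<subseteq> K \<longrightarrow> K = J)" ..
    then obtain K where K: "J = \<aa> K" by blast
    have max: "\<aa> k = \<aa> K" if "\<aa> K \<subseteq> \<aa> k" for k
      using conjunct2[OF J, rule_format, of "\<aa> k"] that K by simp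
    have "\<aa> K \<subseteq> \<aa> k" if "K \<le> k" for k
      using lift_Suc_mono_le[of \<aa>] \<aa> that by blast
    then show "\<exists>K. \<forall>k\<ge>K. \<aa> k = \<aa> K" using max by blast
  qed
next
  assume st: ?stable
  have wf: "wf {(J, I). ideal I R \<and> ideal J R \<and> I \<subset> J}"
    unfolding wf_iff_no_infinite_down_chain
  proof
    assume "\<exists>f. \<forall>i. (f (Suc i), f i) \<in> {(J, I). ideal I R \<and> ideal J R \<and> I \<subset> J}"
    then obtain f where "\<forall>i. (f (Suc i), f i) \<in> {(J, I). ideal I R \<and> ideal J R \<and> I \<subset> J}" ..
    then have f: "\<forall>k. ideal (f k) R \<and> f k \<subseteq> f (Suc k)" and neq: "\<And>k. f (Suc k) \<noteq> f k"
      by (simp_all add: psubset_eq) metis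
    from mp[OF spec[OF st] this(1)] obtain K where K: "\<forall>k\<ge>K. f k = f K" ..
    have "f (Suc K) = f K" by (rule K[rule_format]) simp
    then show False using neq by blast
  qed
  show "noetherian_ring R"
  proof (rule trivial_ideal_chain_imp_noetherian)
    fix C assume C: "C \<noteq> {}" "subset.chain {I. ideal I R} C"
    obtain x where x: "x \<in> C" using C(1) by blast
    from wf[unfolded wf_eq_minimal, rule_format, OF x] obtain M where M: "M \<in> C"
      "\<forall>J. (J, M) \<in> {(J, I). ideal I R \<and> ideal J R \<and> I \<subset> J} \<longrightarrow> J \<notin> C" ..
    have CI: "C \<subseteq> {I. ideal I R}" and tot: "\<forall>I\<in>C. \<forall>J\<in>C. I \<subseteq> J \<or> J \<subseteq> I"
      using C(2) unfolding subset_chain_def by simp_all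
    have "J \<subseteq> M" if J: "J \<in> C" for J
    proof (rule ccontr)
      assume "\<not> J \<subseteq> M"
      then have "M \<subset> J" using tot J M(1) by blast
      moreover have "ideal J R" "ideal M R" using CI J M(1) by auto
      ultimately show False using M(2)[rule_format, of J] J by simp
    qed
    then have "\<Union>C = M" using M(1) by blast
    then show "\<Union>C \<in> C" using M(1) by simp
  qed
qed

text \<open>Preimages of an ascending sequence ascend in \<open>R\<close> and become stable there;
  by surjectivity each ideal is the image of its preimage.\<close>

lemma (in ring_hom_ring) noetherian_image:
  assumes "noetherian_ring R" and surj: "h ` carrier R = carrier S"
  shows "noetherian_ring S"
  unfolding S.noetherian_iff_stable
proof (intro allI impI)
  fix \<aa> :: "nat \<Rightarrow> 'c set"
  assume \<aa>: "\<forall>k. ideal (\<aa> k) S \<and> \<aa> k \<subseteq> \<aa> (Suc k)"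
  define \<bb> where "\<bb> k = {r \<in> carrier R. h r \<in> \<aa> k}" for k
  have "ideal (\<bb> k) R \<and> \<bb> k \<subseteq> \<bb> (Suc k)" for k
    using ideal_vimage[of "\<aa> k"] \<aa> unfolding \<bb>_def by auto
  then obtain K where K: "\<forall>k\<ge>K. \<bb> k = \<bb> K"
    using assms(1) unfolding R.noetherian_iff_stable by blast
  have im: "\<aa> k = h ` \<bb> k" for k
  proof -
    have "\<aa> k \<subseteq> carrier S" using \<aa> by (meson subsetI ideal.Icarr)
    then show ?thesis using surj unfolding \<bb>_def by auto
  qed
  show "\<exists>K. \<forall>k\<ge>K. \<aa> k = \<aa> K"
    using K im by (intro exI[of _ K]) metis
qed

definition annihilator :: "('a, 'b) ring_scheme \<Rightarrow> 'a \<Rightarrow> 'a set" where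
  "annihilator R a = {x \<in> carrier R. x \<otimes>\<^bsub>R\<^esub> a = \<zero>\<^bsub>R\<^esub>}"

context cring
begin

lemma ideal_annihilator:
  assumes a: "a \<in> carrier R"
  shows "ideal (annihilator R a) R"
proof (rule idealI[OF ring_axioms])
  show "subgroup (annihilator R a) (add_monoid R)"
    by (rule add.subgroupI) (use a in \<open>auto simp: annihilator_def l_distr l_minus\<close>)
qed (use a in \<open>auto simp: annihilator_def m_assoc\<close>, metis m_lcomm r_null)

text \<open>An annihilator that is maximal among those of nonzero elements is prime: if
  \<open>y \<otimes> b\<close> is nonzero, its annihilator contains that of \<open>b\<close>, hence
  equals it, so whatever kills \<open>y \<otimes> b\<close> already kills \<open>b\<close>.\<close>

lemma prime_annihilator:
  assumes N: "noetherian_ring R" and a: "a \<in> carrier R" "a \<noteq> \<zero>"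
  obtains b where "b \<in> carrier R" "b \<noteq> \<zero>" "annihilator R a \<subseteq> annihilator R b"
    "primeideal (annihilator R b) R"
proof -
  let ?P = "\<lambda>J. \<exists>b. J = annihilator R b \<and> b \<in> carrier R \<and> b \<noteq> \<zero> \<and> annihilator R a \<subseteq> J"
  have "?P (annihilator R a)" "\<And>J. ?P J \<Longrightarrow> ideal J R" using a ideal_annihilator by blast+
  from noetherian_ring.exists_maximal_ideal[of R ?P, OF N this]
  obtain Q where Q': "?P Q \<and> (\<forall>J. ?P J \<longrightarrow> Q \<subseteq> J \<longrightarrow> J = Q)" ..
  note Q = conjunct1[OF Q'] conjunct2[OF Q', rule_format]
  from Q(1) obtain b where "Q = annihilator R b \<and> b \<in> carrier R \<and> b \<noteq> \<zero> \<and> annihilator R a \<subseteq> Q" ..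
  then have b: "b \<in> carrier R" "b \<noteq> \<zero>" "annihilator R a \<subseteq> annihilator R b" "Q = annihilator R b"
    by blast+
  have "primeideal (annihilator R b) R"
  proof (rule primeidealI[OF ideal_annihilator is_cring])
    show "carrier R \<noteq> annihilator R b"
    proof
      assume "carrier R = annihilator R b"
      then have "\<one> \<in> annihilator R b" using one_closed by simp
      then show False using b by (simp add: annihilator_def)
    qed
  next
    fix x y assume xy: "x \<in> carrier R" "y \<in> carrier R" "x \<otimes> y \<in> annihilator R b"
    show "x \<in> annihilator R b \<or> y \<in> annihilator R b"
    proof (rule disjCI)
      assume "y \<notin> annihilator R b"
      then have nz: "y \<otimes> b \<noteq> \<zero>" using xy by (auto simp: annihilator_def)
      have sub: "annihilator R b \<subseteq> annihilator R (y \<otimes> b)"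
        using xy b by (auto simp: annihilator_def m_lcomm[of _ y])
      then have "annihilator R (y \<otimes> b) = Q"
        using Q(2)[of "annihilator R (y \<otimes> b)"] nz b xy by blast
      moreover have "x \<in> annihilator R (y \<otimes> b)"
        using xy b by (auto simp: annihilator_def m_assoc)
      ultimately show "x \<in> annihilator R b" using b by simp
    qed
  qed (use b in auto)
  then show thesis using that b by blast
qed

lemma ideal_adjoin_element:
  assumes I: "ideal I R" and a: "a \<in> carrier R"
  shows "ideal (I <+>\<^bsub>R\<^esub> PIdl a) R" "I \<subseteq> I <+>\<^bsub>R\<^esub> PIdl a" "a \<in> I <+>\<^bsub>R\<^esub> PIdl a"
    "\<And>x. x \<in> I <+>\<^bsub>R\<^esub> PIdl a \<Longrightarrow> \<exists>i\<in>I. \<exists>r\<in>carrier R. x = i \<oplus> r \<otimes> a"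
proof -
  interpret I: ideal I R by fact
  interpret A: ideal "PIdl a" R using cgenideal_ideal a by simp
  show "ideal (I <+>\<^bsub>R\<^esub> PIdl a) R" by (rule add_ideals[OF I A.ideal_axioms])
  have add: "i \<oplus> k \<in> I <+>\<^bsub>R\<^esub> PIdl a" if "i \<in> I" "k \<in> PIdl a" for i k
    using that unfolding set_add_def' by blast
  show "I \<subseteq> I <+>\<^bsub>R\<^esub> PIdl a"
  proof
    fix i assume "i \<in> I"
    then show "i \<in> I <+>\<^bsub>R\<^esub> PIdl a"
      using add[of i \<zero>] A.zero_closed I.Icarr[of i] by simp
  qed
  show "a \<in> I <+>\<^bsub>R\<^esub> PIdl a"
    using add[of \<zero> a] I.zero_closed cgenideal_self[OF a] a by simp
  show "\<exists>i\<in>I. \<exists>r\<in>carrier R. x = i \<oplus> r \<otimes> a" if "x \<in> I <+>\<^bsub>R\<^esub> PIdl a" for x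
    using that unfolding set_add_def' cgenideal_def by blast
qed

text \<open>Noetherian induction on a weaker property that passes to unions: \<open>?ok I\<close>
  asks for finitely many primes such that each prime over \<open>I\<close> contains one of them. A
  maximal counterexample \<open>J\<close> is not prime, so some \<open>a \<otimes> b\<close> is in
  \<open>J\<close> with \<open>a\<close>, \<open>b\<close> outside. Each prime over \<open>J\<close>
  contains \<open>a\<close> or \<open>b\<close>, so the sets found for the two larger ideals
  together serve \<open>J\<close>.\<close>

lemma finite_minimal_primes:
  assumes N: "noetherian_ring R"
  shows "finite {P. minimal_prime R P}"
proof -
  let ?ok = "\<lambda>I. \<exists>S. finite S \<and> (\<forall>p\<in>S. primeideal p R) \<and>
    (\<forall>Q. primeideal Q R \<and> I \<subseteq> Q \<longrightarrow> (\<exists>p\<in>S. p \<subseteq> Q))"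
  have "?ok I" if "ideal I R" for I
  proof (rule ccontr)
    assume bad: "\<not> ?ok I"
    let ?bad = "\<lambda>I. ideal I R \<and> \<not> ?ok I"
    have "?bad I" "\<And>I. ?bad I \<Longrightarrow> ideal I R" using that bad by simp_all
    from noetherian_ring.exists_maximal_ideal[of R ?bad, OF N this]
    obtain J where J': "?bad J \<and> (\<forall>K. ?bad K \<longrightarrow> J \<subseteq> K \<longrightarrow> K = J)" ..
    note J = conjunct1[OF conjunct1[OF J']] conjunct2[OF conjunct1[OF J']]
      and J3 = conjunct2[OF J', rule_format]
    interpret J: ideal J R by (rule J(1))
    have "\<not> primeideal J R"
    proof
      assume "primeideal J R"
      then have "?ok J" by (intro exI[of _ "{J}"]) auto
      then show False using J(2) by contradiction
    qed
    moreover have "carrier R \<noteq> J"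
    proof
      assume "carrier R = J"
      moreover have "\<not> (primeideal Q R \<and> carrier R \<subseteq> Q)" for Q
        using ideal.Icarr[of Q R] primeideal.axioms(1)[of Q R] primeideal.I_notcarr[of Q R] by blast
      ultimately have "?ok J" by (intro exI[of _ "{}"]) simp
      then show False using J(2) by contradiction
    qed
    ultimately obtain a b where ab: "a \<in> carrier R" "b \<in> carrier R" "a \<otimes> b \<in> J" "a \<notin> J" "b \<notin> J"
      using J.primeidealCD[OF is_cring] by blast
    have ok': "?ok (J <+>\<^bsub>R\<^esub> PIdl c)" if "c \<in> carrier R" "c \<notin> J" for c
      using J3[of "J <+>\<^bsub>R\<^esub> PIdl c"] ideal_adjoin_element(1-3)[OF J.ideal_axioms that(1)] that by blast
    obtain S where S: "finite S" "\<forall>p\<in>S. primeideal p R"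
        "\<forall>Q. primeideal Q R \<and> J <+>\<^bsub>R\<^esub> PIdl a \<subseteq> Q \<longrightarrow> (\<exists>p\<in>S. p \<subseteq> Q)"
      using ok'[of a] ab by blast
    obtain T where T: "finite T" "\<forall>p\<in>T. primeideal p R"
        "\<forall>Q. primeideal Q R \<and> J <+>\<^bsub>R\<^esub> PIdl b \<subseteq> Q \<longrightarrow> (\<exists>p\<in>T. p \<subseteq> Q)"
      using ok'[of b] ab by blast
    have "\<exists>p\<in>S \<union> T. p \<subseteq> Q" if Q: "primeideal Q R" "J \<subseteq> Q" for Q
    proof -
      interpret Q: primeideal Q R by fact
      have le: "J <+>\<^bsub>R\<^esub> PIdl c \<subseteq> Q" if c: "c \<in> carrier R" "c \<in> Q" for c
      proof
        fix x assume "x \<in> J <+>\<^bsub>R\<^esub> PIdl c"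
        then obtain i r where "i \<in> J" "r \<in> carrier R" "x = i \<oplus> r \<otimes> c"
          using ideal_adjoin_element(4)[OF J.ideal_axioms c(1), of x] by blast
        then show "x \<in> Q" using Q c Q.I_l_closed Q.a_closed by (simp add: subset_iff)
      qed
      have "a \<in> Q \<or> b \<in> Q" using Q.I_prime[of a b] ab Q(2) by auto
      then show ?thesis
      proof
        assume "a \<in> Q"
        then have "\<exists>p\<in>S. p \<subseteq> Q" using S(3)[rule_format, of Q] le[of a] ab(1) Q(1) by simp
        then show ?thesis by blast
      next
        assume "b \<in> Q"
        then have "\<exists>p\<in>T. p \<subseteq> Q" using T(3)[rule_format, of Q] le[of b] ab(2) Q(1) by simp
        then show ?thesis by blast
      qed
    qed
    then have "?ok J" using S T by (intro exI[of _ "S \<union> T"]) auto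
    then show False using J(2) by contradiction
  qed
  from this[OF zeroideal] obtain S where S: "finite S" "\<forall>p\<in>S. primeideal p R"
    "\<forall>Q. primeideal Q R \<and> {\<zero>} \<subseteq> Q \<longrightarrow> (\<exists>p\<in>S. p \<subseteq> Q)" by blast
  \<comment> \<open>For the zero ideal every prime contains a member of \<open>S\<close>, and a
    minimal prime must be equal to that member.\<close>
  have "{P. minimal_prime R P} \<subseteq> S"
  proof
    fix P assume "P \<in> {P. minimal_prime R P}"
    then have P: "primeideal P R" "\<And>Q. primeideal Q R \<Longrightarrow> Q \<subseteq> P \<Longrightarrow> Q = P"
      by (auto simp: minimal_prime_def)
    interpret P: primeideal P R by fact
    show "P \<in> S" using S P by (metis P.zero_closed empty_subsetI insert_subset)
  qed
  then show ?thesis using S(1) finite_subset by blast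
qed

lemma exists_in_ideals_not_in_prime:
  assumes p: "primeideal p R" and "finite S" and "\<And>q. q \<in> S \<Longrightarrow> ideal q R \<and> \<not> q \<subseteq> p"
  shows "\<exists>z\<in>carrier R. z \<notin> p \<and> (\<forall>q\<in>S. z \<in> q)"
  using assms(2,3)
proof (induction S)
  case empty
  interpret p: primeideal p R by fact
  show ?case using p.one_imp_carrier p.I_notcarr by auto
next
  case (insert q S)
  interpret p: primeideal p R by fact
  interpret q: ideal q R using insert by simp
  obtain z where z: "z \<in> carrier R" "z \<notin> p" "\<forall>q\<in>S. z \<in> q" using insert by blast
  obtain y where y: "y \<in> q" "y \<notin> p" using insert by blast
  have yc: "y \<in> carrier R" using y q.Icarr by simp
  have "y \<otimes> z \<notin> p" using p.I_prime z y yc by blast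
  moreover have "y \<otimes> z \<in> q" using q.I_r_closed y z by simp
  moreover have "y \<otimes> z \<in> r" if "r \<in> S" for r
    using insert.prems[of r] that z yc ideal.I_l_closed by fastforce
  ultimately show ?case using z yc by blast
qed

text \<open>Induction on the set of primes. If the \<open>x\<close> found for \<open>S\<close> falls
  into the new prime \<open>p\<close>, it is corrected by \<open>y \<otimes> z\<close> with
  \<open>y\<close> in \<open>I\<close> outside \<open>p\<close> and \<open>z\<close> in every member
  of \<open>S\<close> but not in \<open>p\<close>. Pairwise incomparability is what supplies
  \<open>z\<close>; it holds for minimal primes, the case of interest.\<close>

lemma prime_avoidance:
  assumes I: "ideal I R" and "finite S" and "\<And>p. p \<in> S \<Longrightarrow> primeideal p R"
    and "\<And>p q. p \<in> S \<Longrightarrow> q \<in> S \<Longrightarrow> p \<subseteq> q \<Longrightarrow> p = q"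
    and "\<And>p. p \<in> S \<Longrightarrow> \<not> I \<subseteq> p"
  shows "\<exists>x\<in>I. \<forall>p\<in>S. x \<notin> p"
  using assms(2-5)
proof (induction S)
  case empty
  then show ?case using I additive_subgroup.zero_closed ideal.axioms(1) by blast
next
  case (insert p S)
  interpret I: ideal I R by fact
  interpret p: primeideal p R using insert by simp
  obtain x where x: "x \<in> I" "\<forall>q\<in>S. x \<notin> q" 
  proof -
    have "\<exists>x\<in>I. \<forall>q\<in>S. x \<notin> q"
    proof (rule insert.IH)
      show "\<And>q. q \<in> S \<Longrightarrow> primeideal q R" by (rule insert.prems(1)) simp
      show "\<And>q r. q \<in> S \<Longrightarrow> r \<in> S \<Longrightarrow> q \<subseteq> r \<Longrightarrow> q = r" by (rule insert.prems(2)) simp_all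
      show "\<And>q. q \<in> S \<Longrightarrow> \<not> I \<subseteq> q" by (rule insert.prems(3)) simp
    qed
    then show thesis using that by blast
  qed
  show ?case
  proof (cases "x \<in> p")
    case True
    have "ideal q R \<and> \<not> q \<subseteq> p" if q: "q \<in> S" for q
    proof
      show "ideal q R" using insert.prems(1)[of q] q by (simp add: primeideal.axioms(1))
      show "\<not> q \<subseteq> p" using insert.prems(2)[of q p] q insert.hyps(2) by auto
    qed
    from exists_in_ideals_not_in_prime[OF p.primeideal insert.hyps(1) this]
    obtain z where z: "z \<in> carrier R" "z \<notin> p" "\<forall>q\<in>S. z \<in> q" by blast
    obtain y where y: "y \<in> I" "y \<notin> p" using insert.prems(3)[of p] by blast
    have c: "x \<in> carrier R" "y \<in> carrier R" using x y I.Icarr by auto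
    have yz: "y \<otimes> z \<notin> p" using p.I_prime z y c by blast
    have "x \<oplus> y \<otimes> z \<notin> p"
    proof
      assume "x \<oplus> y \<otimes> z \<in> p"
      then have "\<ominus> x \<oplus> (x \<oplus> y \<otimes> z) \<in> p" using True p.a_closed p.a_inv_closed by blast
      then show False using yz c z by (simp add: r_neg1)
    qed
    moreover have "x \<oplus> y \<otimes> z \<notin> q" if q: "q \<in> S" for q
    proof
      interpret q: primeideal q R using insert q by simp
      assume "x \<oplus> y \<otimes> z \<in> q"
      moreover have "y \<otimes> z \<in> q" using z q c q.I_l_closed by blast
      ultimately have "(x \<oplus> y \<otimes> z) \<ominus> y \<otimes> z \<in> q" 
        using q.a_closed q.a_inv_closed by (simp add: a_minus_def)
      moreover have "(x \<oplus> y \<otimes> z) \<ominus> y \<otimes> z = x" using c z by algebra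
      ultimately show False using x q by simp
    qed
    moreover have "x \<oplus> y \<otimes> z \<in> I" using x y z I.a_closed I.I_r_closed by simp
    ultimately show ?thesis by blast
  next
    case False
    then show ?thesis using x by blast
  qed
qed

text \<open>An ideal \<open>P\<close> maximal among those that avoid \<open>M\<close> is prime: if
  \<open>a\<close> and \<open>b\<close> are outside, both enlarged ideals meet \<open>M\<close>, and
  the product of the two meeting points lies in \<open>M\<close> and, when
  \<open>a \<otimes> b\<close> is in \<open>P\<close>, also in \<open>P\<close>.\<close>

lemma exists_prime_disjoint:
  assumes N: "noetherian_ring R" and M: "M \<subseteq> carrier R" "\<one> \<in> M" "\<zero> \<notin> M"
    and mult: "\<And>x y. x \<in> M \<Longrightarrow> y \<in> M \<Longrightarrow> x \<otimes> y \<in> M"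
  shows "\<exists>P. primeideal P R \<and> P \<inter> M = {}"
proof -
  let ?P = "\<lambda>I. ideal I R \<and> I \<inter> M = {}"
  have "?P {\<zero>}" "\<And>I. ?P I \<Longrightarrow> ideal I R" using zeroideal M(3) by auto
  from noetherian_ring.exists_maximal_ideal[of R ?P, OF N this]
  obtain P where P': "?P P \<and> (\<forall>J. ?P J \<longrightarrow> P \<subseteq> J \<longrightarrow> J = P)" ..
  note P = conjunct1[OF conjunct1[OF P']] conjunct2[OF conjunct1[OF P']]
    and P3 = conjunct2[OF P', rule_format]
  interpret P: ideal P R using P by simp
  have meets: "\<exists>i\<in>P. \<exists>r\<in>carrier R. i \<oplus> r \<otimes> c \<in> M" if "c \<in> carrier R" "c \<notin> P" for c
  proof -
    note J = ideal_adjoin_element[OF P.ideal_axioms that(1)]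
    have "(P <+>\<^bsub>R\<^esub> PIdl c) \<inter> M \<noteq> {}" using P3[of "P <+>\<^bsub>R\<^esub> PIdl c"] J(1-3) that by blast
    then show ?thesis using J(4) by blast
  qed
  have "primeideal P R"
  proof (rule primeidealI[OF P.ideal_axioms is_cring])
    show "carrier R \<noteq> P" using M P by auto
  next
    fix a b assume ab: "a \<in> carrier R" "b \<in> carrier R" "a \<otimes> b \<in> P"
    show "a \<in> P \<or> b \<in> P"
    proof (rule ccontr)
      assume "\<not> (a \<in> P \<or> b \<in> P)"
      then obtain i r j s where h: "i \<in> P" "r \<in> carrier R" "i \<oplus> r \<otimes> a \<in> M"
          "j \<in> P" "s \<in> carrier R" "j \<oplus> s \<otimes> b \<in> M"
        using meets[of a] meets[of b] ab by blast
      have c: "i \<in> carrier R" "j \<in> carrier R" using h P.Icarr by auto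
      have "(i \<oplus> r \<otimes> a) \<otimes> (j \<oplus> s \<otimes> b) = i \<otimes> (j \<oplus> s \<otimes> b) \<oplus> ((r \<otimes> a) \<otimes> j \<oplus> (r \<otimes> s) \<otimes> (a \<otimes> b))"
        using c h ab by algebra
      also have "\<dots> \<in> P"
        using c h ab P.a_closed P.I_l_closed P.I_r_closed by simp
      finally show False using mult h P by blast
    qed
  qed
  then show ?thesis using P by blast
qed

text \<open>This is the nilpotency of the maximal ideal in the localization at a minimal prime,
  written without fractions. If it failed, the multiplicative set of all
  \<open>z \<otimes> x [^] n\<close> would miss zero; a prime disjoint from it lies inside
  \<open>Q\<close> and omits \<open>x\<close>, against minimality.\<close>

lemma minimal_prime_power_annihilated:
  assumes N: "noetherian_ring R" and Q: "minimal_prime R Q" and x: "x \<in> Q"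
  shows "\<exists>z\<in>carrier R - Q. \<exists>n::nat. z \<otimes> x [^] n = \<zero>"
proof (rule ccontr)
  assume neg: "\<not> ?thesis"
  interpret Q: primeideal Q R using Q by (simp add: minimal_prime_def)
  have xc: "x \<in> carrier R" using x Q.Icarr by simp
  have one: "\<one> \<in> carrier R - Q" using Q.one_imp_carrier Q.I_notcarr by auto
  let ?M = "{z \<otimes> x [^] (n::nat) |z n. z \<in> carrier R - Q}"
  have "\<exists>P. primeideal P R \<and> P \<inter> ?M = {}"
  proof (rule exists_prime_disjoint[OF N])
    show "?M \<subseteq> carrier R" using xc by auto
    show "\<one> \<in> ?M" using one by (intro CollectI exI[of _ \<one>] exI[of _ 0]) auto
    show "\<zero> \<notin> ?M" using neg by (auto simp: eq_commute)
    fix u v assume "u \<in> ?M" "v \<in> ?M"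
    then obtain z n z' n' where h: "z \<in> carrier R - Q" "z' \<in> carrier R - Q"
      "u = z \<otimes> x [^] (n::nat)" "v = z' \<otimes> x [^] (n'::nat)" by blast
    have "u \<otimes> v = (z \<otimes> z') \<otimes> x [^] (n + n')"
      using h xc by (simp add: nat_pow_mult[symmetric] m_ac)
    moreover have "z \<otimes> z' \<in> carrier R - Q" using h Q.I_prime by blast
    ultimately show "u \<otimes> v \<in> ?M" by blast
  qed
  then obtain P where P: "primeideal P R" "P \<inter> ?M = {}" by blast
  interpret P: primeideal P R by fact
  have "P \<subseteq> Q"
  proof (rule ccontr)
    assume "\<not> P \<subseteq> Q"
    then obtain z where "z \<in> P" "z \<notin> Q" by blast
    then have z: "z \<in> P" "z \<in> carrier R - Q" using P.Icarr by auto
    then have "z \<otimes> x [^] (0::nat) \<in> ?M" by blast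
    then show False using P(2) z by auto
  qed
  then have "x \<in> P" using Q P(1) x by (auto simp: minimal_prime_def)
  moreover have "x \<in> ?M" using one xc by (intro CollectI exI[of _ \<one>] exI[of _ 1]) auto
  ultimately show False using P by blast
qed

end

section \<open>Localization and Serre's condition\<close>

context primeideal
begin

abbreviation denominators :: "'a set" where "denominators \<equiv> carrier R - I"

abbreviation frac :: "'a \<Rightarrow> 'a \<Rightarrow> ('a \<times> 'a) set" where "frac \<equiv> fraction R I"

abbreviation loc :: "('a \<times> 'a) set ring" where "loc \<equiv> localization R I"

lemma denominators_mult: "s \<in> denominators \<Longrightarrow> t \<in> denominators \<Longrightarrow> s \<otimes> t \<in> denominators"
  using I_prime by auto

lemma denominators_one: "\<one> \<in> denominators"
  using one_imp_carrier I_notcarr by auto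

lemma denominators_carrier: "s \<in> denominators \<Longrightarrow> s \<in> carrier R"
  by simp

lemma frac_subset:
  assumes "a \<in> carrier R" "s \<in> denominators" "b \<in> carrier R" "t \<in> denominators"
    and u: "u \<in> denominators" "u \<otimes> (a \<otimes> t) = u \<otimes> (b \<otimes> s)"
  shows "frac a s \<subseteq> frac b t"
proof
  fix x assume x: "x \<in> frac a s"
  then obtain c r v where cr: "x = (c, r)" "c \<in> carrier R" "r \<in> denominators"
      "v \<in> denominators" "v \<otimes> (a \<otimes> r) = v \<otimes> (c \<otimes> s)"
    unfolding fraction_def by auto
  have car: "a \<in> carrier R" "b \<in> carrier R" "c \<in> carrier R" "s \<in> carrier R" "t \<in> carrier R"
    "r \<in> carrier R" "u \<in> carrier R" "v \<in> carrier R" using assms cr by auto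
  \<comment> \<open>Transitivity of equality of fractions: eliminating the middle fraction costs its
    denominator, so the witness is the product of both given witnesses with
    \<open>s\<close>.\<close>
  have "(u \<otimes> v \<otimes> s) \<otimes> (b \<otimes> r) = (v \<otimes> r) \<otimes> (u \<otimes> (b \<otimes> s))" using car by (simp add: m_ac)
  also have "\<dots> = (v \<otimes> r) \<otimes> (u \<otimes> (a \<otimes> t))" by (simp only: u)
  also have "\<dots> = (u \<otimes> t) \<otimes> (v \<otimes> (a \<otimes> r))" using car by (simp add: m_ac)
  also have "\<dots> = (u \<otimes> t) \<otimes> (v \<otimes> (c \<otimes> s))" by (simp only: cr)
  also have "\<dots> = (u \<otimes> v \<otimes> s) \<otimes> (c \<otimes> t)" using car by (simp add: m_ac)
  finally have eq: "(u \<otimes> v \<otimes> s) \<otimes> (b \<otimes> r) = (u \<otimes> v \<otimes> s) \<otimes> (c \<otimes> t)" .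
  have "u \<otimes> v \<otimes> s \<in> denominators" by (intro denominators_mult assms cr)
  then show "x \<in> frac b t" using cr eq unfolding fraction_def by auto
qed

lemma frac_eq_iff:
  assumes "a \<in> carrier R" "s \<in> denominators" "b \<in> carrier R" "t \<in> denominators"
  shows "frac a s = frac b t \<longleftrightarrow> (\<exists>u\<in>denominators. u \<otimes> (a \<otimes> t) = u \<otimes> (b \<otimes> s))"
proof
  assume eq: "frac a s = frac b t"
  have "(b, t) \<in> frac b t" using assms denominators_one unfolding fraction_def by auto
  then have "(b, t) \<in> frac a s" using eq by simp
  then show "\<exists>u\<in>denominators. u \<otimes> (a \<otimes> t) = u \<otimes> (b \<otimes> s)" unfolding fraction_def by simp
next
  assume "\<exists>u\<in>denominators. u \<otimes> (a \<otimes> t) = u \<otimes> (b \<otimes> s)"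
  then obtain u where u: "u \<in> denominators" "u \<otimes> (a \<otimes> t) = u \<otimes> (b \<otimes> s)" by auto
  show "frac a s = frac b t"
    using frac_subset[OF assms u] frac_subset[OF assms(3,4,1,2) u(1) u(2)[symmetric]] by simp
qed

lemma frac_eqI:
  assumes "a \<in> carrier R" "s \<in> denominators" "b \<in> carrier R" "t \<in> denominators"
    and "a \<otimes> t = b \<otimes> s"
  shows "frac a s = frac b t"
  unfolding frac_eq_iff[OF assms(1-4)] using denominators_one assms(5) by (intro bexI[of _ \<one>]) simp

lemma mem_frac_iff:
  assumes "a \<in> carrier R" "s \<in> denominators"
  shows "(b, t) \<in> frac a s \<longleftrightarrow> b \<in> carrier R \<and> t \<in> denominators \<and> frac b t = frac a s"
proof -
  have "(b, t) \<in> frac a s \<longleftrightarrow>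
      b \<in> carrier R \<and> t \<in> denominators \<and> (\<exists>u\<in>denominators. u \<otimes> (a \<otimes> t) = u \<otimes> (b \<otimes> s))"
    unfolding fraction_def by simp
  then show ?thesis using frac_eq_iff[OF assms, of b t] by auto
qed

lemma frac_mult_cong:
  assumes a: "a \<in> carrier R" "s \<in> denominators" "a' \<in> carrier R" "s' \<in> denominators"
      "frac a s = frac a' s'"
    and b: "b \<in> carrier R" "t \<in> denominators" "b' \<in> carrier R" "t' \<in> denominators"
      "frac b t = frac b' t'"
  shows "frac (a \<otimes> b) (s \<otimes> t) = frac (a' \<otimes> b') (s' \<otimes> t')"
    and "frac (a \<otimes> t \<oplus> b \<otimes> s) (s \<otimes> t) = frac (a' \<otimes> t' \<oplus> b' \<otimes> s') (s' \<otimes> t')"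
proof -
  obtain u where u: "u \<in> denominators" "u \<otimes> (a \<otimes> s') = u \<otimes> (a' \<otimes> s)"
    using frac_eq_iff a by auto
  obtain v where v: "v \<in> denominators" "v \<otimes> (b \<otimes> t') = v \<otimes> (b' \<otimes> t)"
    using frac_eq_iff b by auto
  have car: "a \<in> carrier R" "b \<in> carrier R" "a' \<in> carrier R" "b' \<in> carrier R" "s \<in> carrier R"
    "t \<in> carrier R" "s' \<in> carrier R" "t' \<in> carrier R" "u \<in> carrier R" "v \<in> carrier R"
    using a b u v by auto
  note den = denominators_mult[OF a(2) b(2)] denominators_mult[OF a(4) b(4)]
  have "(u \<otimes> v) \<otimes> ((a \<otimes> b) \<otimes> (s' \<otimes> t')) = (u \<otimes> (a \<otimes> s')) \<otimes> (v \<otimes> (b \<otimes> t'))"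
    using car by (simp add: m_ac)
  also have "\<dots> = (u \<otimes> (a' \<otimes> s)) \<otimes> (v \<otimes> (b' \<otimes> t))" by (simp only: u v)
  also have "\<dots> = (u \<otimes> v) \<otimes> ((a' \<otimes> b') \<otimes> (s \<otimes> t))" using car by (simp add: m_ac)
  finally show "frac (a \<otimes> b) (s \<otimes> t) = frac (a' \<otimes> b') (s' \<otimes> t')"
    using den car denominators_mult[OF u(1) v(1)] by (subst frac_eq_iff) auto
  have "(u \<otimes> v) \<otimes> ((a \<otimes> t \<oplus> b \<otimes> s) \<otimes> (s' \<otimes> t'))
      = (u \<otimes> (a \<otimes> s')) \<otimes> (v \<otimes> (t \<otimes> t')) \<oplus> (v \<otimes> (b \<otimes> t')) \<otimes> (u \<otimes> (s \<otimes> s'))"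
    using car by (simp add: l_distr r_distr m_ac)
  also have "\<dots> = (u \<otimes> (a' \<otimes> s)) \<otimes> (v \<otimes> (t \<otimes> t')) \<oplus> (v \<otimes> (b' \<otimes> t)) \<otimes> (u \<otimes> (s \<otimes> s'))"
    by (simp only: u v)
  also have "\<dots> = (u \<otimes> v) \<otimes> ((a' \<otimes> t' \<oplus> b' \<otimes> s') \<otimes> (s \<otimes> t))"
    using car by (simp add: l_distr r_distr m_ac)
  finally show "frac (a \<otimes> t \<oplus> b \<otimes> s) (s \<otimes> t) = frac (a' \<otimes> t' \<oplus> b' \<otimes> s') (s' \<otimes> t')"
    using den car denominators_mult[OF u(1) v(1)] by (subst frac_eq_iff) auto
qed

lemma loc_mult:
  assumes "a \<in> carrier R" "s \<in> denominators" "b \<in> carrier R" "t \<in> denominators"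
  shows "frac a s \<otimes>\<^bsub>loc\<^esub> frac b t = frac (a \<otimes> b) (s \<otimes> t)"
proof -
  have "{frac (a' \<otimes> b') (s' \<otimes> t') |a' s' b' t'. (a', s') \<in> frac a s \<and> (b', t') \<in> frac b t}
      = {frac (a \<otimes> b) (s \<otimes> t)}" (is "?S = _")
  proof
    show "?S \<subseteq> {frac (a \<otimes> b) (s \<otimes> t)}"
    proof
      fix x assume "x \<in> ?S"
      then obtain a' s' b' t' where h: "x = frac (a' \<otimes> b') (s' \<otimes> t')"
        "(a', s') \<in> frac a s" "(b', t') \<in> frac b t" by auto
      then show "x \<in> {frac (a \<otimes> b) (s \<otimes> t)}"
        using frac_mult_cong(1)[of a' s' a s b' t' b t] assms by (simp add: mem_frac_iff)
    qed
    show "{frac (a \<otimes> b) (s \<otimes> t)} \<subseteq> ?S"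
      using assms by (auto simp: mem_frac_iff)
  qed
  then show ?thesis by (simp add: localization_def)
qed

lemma loc_add:
  assumes "a \<in> carrier R" "s \<in> denominators" "b \<in> carrier R" "t \<in> denominators"
  shows "frac a s \<oplus>\<^bsub>loc\<^esub> frac b t = frac (a \<otimes> t \<oplus> b \<otimes> s) (s \<otimes> t)"
proof -
  have "{frac (a' \<otimes> t' \<oplus> b' \<otimes> s') (s' \<otimes> t') |a' s' b' t'. (a', s') \<in> frac a s \<and> (b', t') \<in> frac b t}
      = {frac (a \<otimes> t \<oplus> b \<otimes> s) (s \<otimes> t)}" (is "?S = _")
  proof
    show "?S \<subseteq> {frac (a \<otimes> t \<oplus> b \<otimes> s) (s \<otimes> t)}"
    proof
      fix x assume "x \<in> ?S"
      then obtain a' s' b' t' where h: "x = frac (a' \<otimes> t' \<oplus> b' \<otimes> s') (s' \<otimes> t')"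
        "(a', s') \<in> frac a s" "(b', t') \<in> frac b t" by auto
      then show "x \<in> {frac (a \<otimes> t \<oplus> b \<otimes> s) (s \<otimes> t)}"
        using frac_mult_cong(2)[of a' s' a s b' t' b t] assms by (simp add: mem_frac_iff)
    qed
    show "{frac (a \<otimes> t \<oplus> b \<otimes> s) (s \<otimes> t)} \<subseteq> ?S"
      using assms by (auto simp: mem_frac_iff)
  qed
  then show ?thesis by (simp add: localization_def)
qed

lemma loc_zero: "\<zero>\<^bsub>loc\<^esub> = frac \<zero> \<one>" and loc_one: "\<one>\<^bsub>loc\<^esub> = frac \<one> \<one>"
  by (simp_all add: localization_def)

lemma frac_in_loc: "a \<in> carrier R \<Longrightarrow> s \<in> denominators \<Longrightarrow> frac a s \<in> carrier loc"
  by (auto simp: localization_def)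

lemma loc_cases:
  assumes "x \<in> carrier loc"
  obtains a s where "a \<in> carrier R" "s \<in> denominators" "x = frac a s"
  using assms by (auto simp: localization_def)

lemma cring_localization: "cring loc"
proof (rule cringI)
  note simps = loc_mult loc_add loc_zero loc_one denominators_mult denominators_one
  show "abelian_group loc"
  proof (rule abelian_groupI)
    fix x y assume "x \<in> carrier loc" "y \<in> carrier loc"
    then obtain a s b t where h: "a \<in> carrier R" "s \<in> denominators" "x = frac a s"
      "b \<in> carrier R" "t \<in> denominators" "y = frac b t" by (elim loc_cases)
    note car = h(1,4) denominators_carrier[OF h(2)] denominators_carrier[OF h(5)]
    show "x \<oplus>\<^bsub>loc\<^esub> y \<in> carrier loc"
      unfolding h(3,6) loc_add[OF h(1,2,4,5)]
      using car denominators_mult[OF h(2,5)] by (intro frac_in_loc) auto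
    show "x \<oplus>\<^bsub>loc\<^esub> y = y \<oplus>\<^bsub>loc\<^esub> x"
      unfolding h(3,6) loc_add[OF h(1,2,4,5)] loc_add[OF h(4,5,1,2)]
      using car by (simp add: a_comm m_comm)
  next
    show "\<zero>\<^bsub>loc\<^esub> \<in> carrier loc"
      unfolding loc_zero using denominators_one by (intro frac_in_loc) auto
  next
    fix x y z assume "x \<in> carrier loc" "y \<in> carrier loc" "z \<in> carrier loc"
    then obtain a s b t c r where h: "a \<in> carrier R" "s \<in> denominators" "x = frac a s"
      "b \<in> carrier R" "t \<in> denominators" "y = frac b t"
      "c \<in> carrier R" "r \<in> denominators" "z = frac c r" by (elim loc_cases)
    note car = h(1,4,7) h(2,5,8)[THEN denominators_carrier]
    note den = denominators_mult[OF h(2,5)] denominators_mult[OF h(5,8)]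
    show "x \<oplus>\<^bsub>loc\<^esub> y \<oplus>\<^bsub>loc\<^esub> z = x \<oplus>\<^bsub>loc\<^esub> (y \<oplus>\<^bsub>loc\<^esub> z)"
      unfolding h(3,6,9) using h(1,2,4,5,7,8) den car
      by (simp add: loc_add del: Diff_iff) (simp add: l_distr r_distr m_ac a_ac)
  next
    fix x assume "x \<in> carrier loc"
    then obtain a s where h: "a \<in> carrier R" "s \<in> denominators" "x = frac a s"
      by (elim loc_cases)
    note car = h(1) denominators_carrier[OF h(2)]
    show "\<zero>\<^bsub>loc\<^esub> \<oplus>\<^bsub>loc\<^esub> x = x"
      unfolding h(3) loc_zero loc_add[OF zero_closed denominators_one h(1,2)]
      using car by simp
    have "frac (\<ominus> a) s \<oplus>\<^bsub>loc\<^esub> x = \<zero>\<^bsub>loc\<^esub>"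
      unfolding h(3) loc_zero loc_add[OF a_inv_closed[OF h(1)] h(2) h(1,2)]
      using car denominators_mult[OF h(2,2)] denominators_one
      by (intro frac_eqI) (auto simp: l_minus l_neg)
    then show "\<exists>y\<in>carrier loc. y \<oplus>\<^bsub>loc\<^esub> x = \<zero>\<^bsub>loc\<^esub>"
      using frac_in_loc[OF a_inv_closed[OF h(1)] h(2)] by auto
  qed
  show "comm_monoid loc"
  proof (rule comm_monoidI)
    fix x y assume "x \<in> carrier loc" "y \<in> carrier loc"
    then obtain a s b t where h: "a \<in> carrier R" "s \<in> denominators" "x = frac a s"
      "b \<in> carrier R" "t \<in> denominators" "y = frac b t" by (elim loc_cases)
    note car = h(1,4) denominators_carrier[OF h(2)] denominators_carrier[OF h(5)]
    show "x \<otimes>\<^bsub>loc\<^esub> y \<in> carrier loc"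
      unfolding h(3,6) loc_mult[OF h(1,2,4,5)]
      using car denominators_mult[OF h(2,5)] by (intro frac_in_loc) auto
    show "x \<otimes>\<^bsub>loc\<^esub> y = y \<otimes>\<^bsub>loc\<^esub> x"
      unfolding h(3,6) loc_mult[OF h(1,2,4,5)] loc_mult[OF h(4,5,1,2)]
      using car by (simp add: m_comm)
  next
    show "\<one>\<^bsub>loc\<^esub> \<in> carrier loc"
      unfolding loc_one using denominators_one by (intro frac_in_loc) auto
  next
    fix x y z assume "x \<in> carrier loc" "y \<in> carrier loc" "z \<in> carrier loc"
    then obtain a s b t c r where h: "a \<in> carrier R" "s \<in> denominators" "x = frac a s"
      "b \<in> carrier R" "t \<in> denominators" "y = frac b t"
      "c \<in> carrier R" "r \<in> denominators" "z = frac c r" by (elim loc_cases)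
    note car = h(1,4,7) h(2,5,8)[THEN denominators_carrier]
    note den = denominators_mult[OF h(2,5)] denominators_mult[OF h(5,8)]
    show "x \<otimes>\<^bsub>loc\<^esub> y \<otimes>\<^bsub>loc\<^esub> z = x \<otimes>\<^bsub>loc\<^esub> (y \<otimes>\<^bsub>loc\<^esub> z)"
      unfolding h(3,6,9) using h(1,2,4,5,7,8) den car
      by (simp add: loc_mult del: Diff_iff) (simp add: m_assoc)
  next
    fix x assume "x \<in> carrier loc"
    then obtain a s where h: "a \<in> carrier R" "s \<in> denominators" "x = frac a s"
      by (elim loc_cases)
    show "\<one>\<^bsub>loc\<^esub> \<otimes>\<^bsub>loc\<^esub> x = x"
      unfolding h(3) loc_one loc_mult[OF one_closed denominators_one h(1,2)]
      using h denominators_carrier[OF h(2)] by simp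
  qed
  fix x y z assume "x \<in> carrier loc" "y \<in> carrier loc" "z \<in> carrier loc"
  then obtain a s b t c r where h: "a \<in> carrier R" "s \<in> denominators" "x = frac a s"
    "b \<in> carrier R" "t \<in> denominators" "y = frac b t"
    "c \<in> carrier R" "r \<in> denominators" "z = frac c r" by (elim loc_cases)
  note car = h(1,4,7) h(2,5,8)[THEN denominators_carrier]
  note den = denominators_mult[OF h(2,5)] denominators_mult[OF h(5,8)] denominators_mult[OF h(2,8)]
  show "(x \<oplus>\<^bsub>loc\<^esub> y) \<otimes>\<^bsub>loc\<^esub> z = x \<otimes>\<^bsub>loc\<^esub> z \<oplus>\<^bsub>loc\<^esub> y \<otimes>\<^bsub>loc\<^esub> z"
  proof -
    have "(x \<oplus>\<^bsub>loc\<^esub> y) \<otimes>\<^bsub>loc\<^esub> z = frac ((a \<otimes> t \<oplus> b \<otimes> s) \<otimes> c) ((s \<otimes> t) \<otimes> r)"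
      unfolding h(3,6,9) using h(1,2,4,5,7,8) den car by (simp add: loc_add loc_mult del: Diff_iff)
    moreover have "x \<otimes>\<^bsub>loc\<^esub> z \<oplus>\<^bsub>loc\<^esub> y \<otimes>\<^bsub>loc\<^esub> z
        = frac ((a \<otimes> c) \<otimes> (t \<otimes> r) \<oplus> (b \<otimes> c) \<otimes> (s \<otimes> r)) ((s \<otimes> r) \<otimes> (t \<otimes> r))"
      unfolding h(3,6,9) using h(1,2,4,5,7,8) den car by (simp add: loc_add loc_mult del: Diff_iff)
    \<comment> \<open>The two sides carry different denominators, one having the additional factor
      \<open>r\<close>, so they agree as fractions and not term by term.\<close>
    moreover have "frac ((a \<otimes> t \<oplus> b \<otimes> s) \<otimes> c) ((s \<otimes> t) \<otimes> r)
        = frac ((a \<otimes> c) \<otimes> (t \<otimes> r) \<oplus> (b \<otimes> c) \<otimes> (s \<otimes> r)) ((s \<otimes> r) \<otimes> (t \<otimes> r))"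
      using car denominators_mult[OF den(1) h(8)] denominators_mult[OF den(3,2)]
      by (intro frac_eqI) (simp_all add: l_distr r_distr m_ac)
    ultimately show ?thesis by simp
  qed
qed

lemma loc_ring_hom: "(\<lambda>a. frac a \<one>) \<in> ring_hom R loc"
  by (rule ring_hom_memI)
    (simp_all add: frac_in_loc denominators_one[simplified] loc_mult loc_add loc_one)

lemma contraction_prime:
  assumes Q: "primeideal Q loc"
  shows "primeideal {a \<in> carrier R. frac a \<one> \<in> Q} R"
proof -
  interpret L: cring loc by (rule cring_localization)
  interpret h: ring_hom_ring R loc "\<lambda>a. frac a \<one>"
    using loc_ring_hom by (intro ring_hom_ringI2 ring_axioms L.ring_axioms)
  show ?thesis using h.primeideal_vimage[OF is_cring Q] .
qed

text \<open>The two fractions differ by the unit \<open>frac s \<one>\<close>. Hence an ideal of the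
  localization is determined by the elements with denominator one that it contains.\<close>

lemma frac_in_loc_prime_iff:
  assumes Q: "ideal Q loc" and a: "a \<in> carrier R" "s \<in> denominators"
  shows "frac a s \<in> Q \<longleftrightarrow> frac a \<one> \<in> Q"
proof -
  interpret Q: ideal Q loc by fact
  have s: "s \<in> carrier R" using a by simp
  have 1: "frac a \<one> = frac s \<one> \<otimes>\<^bsub>loc\<^esub> frac a s"
    unfolding loc_mult[OF s denominators_one a]
    using a s denominators_one denominators_mult[OF denominators_one a(2)]
    by (intro frac_eqI) (simp_all add: m_comm)
  have 2: "frac a s = frac \<one> s \<otimes>\<^bsub>loc\<^esub> frac a \<one>"
    unfolding loc_mult[OF one_closed a(2) a(1) denominators_one] using a s by simp
  show ?thesis
    using 1 2 Q.I_l_closed frac_in_loc[OF s denominators_one] frac_in_loc[OF one_closed a(2)] by metis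
qed

text \<open>An element outside \<open>I\<close> becomes a unit of the localization, and a prime
  contains no unit.\<close>

lemma contraction_subset:
  assumes Q: "primeideal Q loc" and a: "a \<in> carrier R" "frac a \<one> \<in> Q"
  shows "a \<in> I"
proof (rule ccontr)
  interpret Q: primeideal Q loc by fact
  assume "a \<notin> I"
  then have a': "a \<in> denominators" using a by simp
  have "frac \<one> a \<otimes>\<^bsub>loc\<^esub> frac a \<one> = \<one>\<^bsub>loc\<^esub>"
    unfolding loc_mult[OF one_closed a' a(1) denominators_one] loc_one
    using a a' denominators_one by (intro frac_eqI) simp_all
  then have "\<one>\<^bsub>loc\<^esub> \<in> Q"
    using Q.I_l_closed[OF a(2) frac_in_loc[OF one_closed a']] by simp
  then show False using Q.one_imp_carrier Q.I_notcarr by simp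
qed

text \<open>For \<open>Q = I\<close> this is \<open>localization_maximal R I\<close>, so the maximal
  ideal is treated together with the other extended primes.\<close>

definition extension :: "'a set \<Rightarrow> ('a \<times> 'a) set set" where
  "extension Q = {frac a s |a s. a \<in> Q \<and> s \<in> denominators}"

text \<open>Since \<open>Q \<subseteq> I\<close>, no denominator lies in \<open>Q\<close>, and
  primality cancels the denominator \<open>t\<close> and the witness \<open>u\<close> from the
  equation between fractions.\<close>

lemma frac_in_extension_iff:
  assumes Q: "primeideal Q R" "Q \<subseteq> I" and a: "a \<in> carrier R" "s \<in> denominators"
  shows "frac a s \<in> extension Q \<longleftrightarrow> a \<in> Q"
proof
  interpret Q: primeideal Q R by fact
  assume "frac a s \<in> extension Q"
  then obtain b t where b: "b \<in> Q" "t \<in> denominators" "frac a s = frac b t"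
    unfolding extension_def by auto
  have bc: "b \<in> carrier R" using b Q.Icarr by simp
  obtain u where u: "u \<in> denominators" "u \<otimes> (a \<otimes> t) = u \<otimes> (b \<otimes> s)"
    using b(3) frac_eq_iff[OF a bc b(2)] by auto
  have c: "u \<in> carrier R" "t \<in> carrier R" "s \<in> carrier R" using u a b by auto
  have "u \<otimes> (b \<otimes> s) \<in> Q" using b(1) c by (simp add: Q.I_l_closed Q.I_r_closed)
  then have "u \<otimes> (a \<otimes> t) \<in> Q" using u by simp
  moreover have "u \<notin> Q" "t \<notin> Q" using u b Q(2) by auto
  ultimately show "a \<in> Q"
    using Q.I_prime[of u "a \<otimes> t"] Q.I_prime[of a t] a c by auto
qed (use a in \<open>auto simp: extension_def\<close>)

lemma extension_prime:
  assumes Q: "primeideal Q R" "Q \<subseteq> I"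
  shows "primeideal (extension Q) loc"
proof -
  interpret Q: primeideal Q R by fact
  interpret L: cring loc by (rule cring_localization)
  note iff = frac_in_extension_iff[OF Q]
  have minus: "\<ominus>\<^bsub>loc\<^esub> frac a s = frac (\<ominus> a) s" if a: "a \<in> carrier R" "s \<in> denominators" for a s
  proof (rule L.minus_equality[OF _ frac_in_loc[OF a] frac_in_loc[OF a_inv_closed[OF a(1)] a(2)]])
    have s: "s \<in> carrier R" using a by simp
    show "frac (\<ominus> a) s \<oplus>\<^bsub>loc\<^esub> frac a s = \<zero>\<^bsub>loc\<^esub>"
      unfolding loc_zero loc_add[OF a_inv_closed[OF a(1)] a(2) a]
      using a s denominators_mult[OF a(2,2)] denominators_one
      by (intro frac_eqI) (auto simp: l_minus l_neg)
  qed
  have sub: "extension Q \<subseteq> carrier loc"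
    unfolding extension_def using Q.Icarr frac_in_loc by auto
  have cases: "\<exists>a s. a \<in> Q \<and> a \<in> carrier R \<and> s \<in> denominators \<and> x = frac a s"
    if "x \<in> extension Q" for x
    using that Q.Icarr unfolding extension_def by auto
  have "additive_subgroup (extension Q) loc"
  proof (rule additive_subgroup.intro, rule L.add.subgroupI)
    show "extension Q \<subseteq> carrier loc" by (rule sub)
    have "frac \<zero> \<one> \<in> extension Q" using iff[OF zero_closed denominators_one] by simp
    then show "extension Q \<noteq> {}" by auto
  next
    fix x assume "x \<in> extension Q"
    then obtain a s where x: "a \<in> Q" "a \<in> carrier R" "s \<in> denominators" "x = frac a s"
      using cases[of x] by auto
    have "frac (\<ominus> a) s \<in> extension Q" using iff[OF a_inv_closed[OF x(2)] x(3)] x by simp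
    then show "\<ominus>\<^bsub>loc\<^esub> x \<in> extension Q"
      using minus[OF x(2,3)] x(4) by simp
  next
    fix x y assume "x \<in> extension Q" "y \<in> extension Q"
    then obtain a s b t where x: "a \<in> Q" "a \<in> carrier R" "s \<in> denominators" "x = frac a s"
      and y: "b \<in> Q" "b \<in> carrier R" "t \<in> denominators" "y = frac b t"
      using cases[of x] cases[of y] by auto
    have c: "s \<in> carrier R" "t \<in> carrier R" using x y by auto
    have "frac (a \<otimes> t \<oplus> b \<otimes> s) (s \<otimes> t) \<in> extension Q"
      using iff[of "a \<otimes> t \<oplus> b \<otimes> s" "s \<otimes> t"] denominators_mult[OF x(3) y(3)] x(1,2) y(1,2) c
        Q.I_r_closed by simp
    then show "x \<oplus>\<^bsub>loc\<^esub> y \<in> extension Q"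
      using loc_add[OF x(2,3) y(2,3)] x(4) y(4) by simp
  qed
  then show ?thesis
  proof (rule primeidealI2[OF _ cring_localization])
    fix x y assume "x \<in> extension Q" and y: "y \<in> carrier loc"
    then obtain a s where x: "a \<in> Q" "a \<in> carrier R" "s \<in> denominators" "x = frac a s"
      using cases[of x] by auto
    obtain b t where b: "b \<in> carrier R" "t \<in> denominators" "y = frac b t"
      using y by (elim loc_cases)
    have "frac (b \<otimes> a) (t \<otimes> s) \<in> extension Q"
      using iff[of "b \<otimes> a" "t \<otimes> s"] denominators_mult[OF b(2) x(3)] x(1,2) b(1) Q.I_l_closed by simp
    then show yx: "y \<otimes>\<^bsub>loc\<^esub> x \<in> extension Q"
      using loc_mult[OF b(1,2) x(2,3)] x(4) b(3) by simp
    have "x \<in> carrier loc" using x frac_in_loc by simp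
    then show "x \<otimes>\<^bsub>loc\<^esub> y \<in> extension Q" using yx y L.m_comm by simp
  next
    have "frac \<one> \<one> \<notin> extension Q"
      using iff[OF one_closed denominators_one] Q.one_imp_carrier Q.I_notcarr by auto
    then show "carrier loc \<noteq> extension Q"
      using frac_in_loc[OF one_closed denominators_one] by auto
  next
    fix x y assume "x \<in> carrier loc" "y \<in> carrier loc" and xy: "x \<otimes>\<^bsub>loc\<^esub> y \<in> extension Q"
    then obtain a s b t where h: "a \<in> carrier R" "s \<in> denominators" "x = frac a s"
      "b \<in> carrier R" "t \<in> denominators" "y = frac b t" by (elim loc_cases)
    have "a \<otimes> b \<in> Q"
      using xy iff[of "a \<otimes> b" "s \<otimes> t"] h denominators_mult[OF h(2,5)] loc_mult[OF h(1,2,4,5)] by simp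
    then show "x \<in> extension Q \<or> y \<in> extension Q"
      using Q.I_prime[OF h(1,4)] iff[OF h(1,2)] iff[OF h(4,5)] h(3,6) by simp
  qed
qed

section \<open>Dimension and depth of a localization, and their meaning for S_1\<close>

lemma krull_dim_localization_pos:
  assumes Q: "primeideal Q R" "Q \<subset> I"
  shows "1 \<le> krull_dim loc"
proof -
  have QI: "Q \<subseteq> I" using Q by auto
  define P where "P n = (if n = 0 then extension Q else extension I)" for n :: nat
  obtain a where a: "a \<in> I" "a \<notin> Q" using Q by auto
  have ac: "a \<in> carrier R" using a Icarr by simp
  note one = denominators_one
  have "extension Q \<subseteq> extension I" unfolding extension_def using QI by auto
  moreover have "frac a \<one> \<in> extension I" "frac a \<one> \<notin> extension Q"
    using frac_in_extension_iff[OF primeideal subset_refl ac one]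
      frac_in_extension_iff[OF Q(1) QI ac one] a by simp_all
  ultimately have "extension Q \<subset> extension I" by auto
  then have "prime_chain loc 1 P"
    using extension_prime[OF Q(1) QI] extension_prime[OF primeideal subset_refl]
    unfolding prime_chain_def P_def by simp
  then have "enat 1 \<le> krull_dim loc"
    unfolding krull_dim_def by (intro Sup_upper CollectI exI[of _ 1]) auto
  then show ?thesis by (simp add: one_enat_def)
qed

text \<open>Every prime of the localization contracts into \<open>I\<close>, hence onto
  \<open>I\<close> by minimality; as a prime is determined by its contraction, two primes cannot be
  strictly nested.\<close>

lemma krull_dim_localization_minimal:
  assumes min: "minimal_prime R I"
  shows "krull_dim loc = 0"
proof -
  have "n = 0" if "prime_chain loc n P" for n P
  proof (rule ccontr)
    assume "n \<noteq> 0"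
    then have P: "primeideal (P 0) loc" "primeideal (P 1) loc" "P 0 \<subset> P 1"
      using that unfolding prime_chain_def by (auto simp: Suc_le_eq)
    have contr: "{a \<in> carrier R. frac a \<one> \<in> Q} = I" if Q: "primeideal Q loc" for Q
    proof -
      have "{a \<in> carrier R. frac a \<one> \<in> Q} \<subseteq> I" using contraction_subset[OF Q] by auto
      then show ?thesis using min contraction_prime[OF Q] unfolding minimal_prime_def by simp
    qed
    obtain x where x: "x \<in> P 1" "x \<notin> P 0" using P(3) by auto
    interpret P1: primeideal "P 1" loc by (rule P(2))
    obtain a s where a: "a \<in> carrier R" "s \<in> denominators" "x = frac a s"
      using P1.Icarr[OF x(1)] by (elim loc_cases)
    have "frac a \<one> \<in> P 1" "frac a \<one> \<notin> P 0"
      using frac_in_loc_prime_iff[OF primeideal.axioms(1)[OF P(1)] a(1,2)]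
        frac_in_loc_prime_iff[OF primeideal.axioms(1)[OF P(2)] a(1,2)] x a(3) by simp_all
    then show False using contr[OF P(1)] contr[OF P(2)] a(1) by auto
  qed
  then have "{enat n |n. \<exists>P. prime_chain loc n P} \<subseteq> {0}"
    by (auto simp: zero_enat_def)
  then have "krull_dim loc \<le> Sup {0}" unfolding krull_dim_def by (rule Sup_subset_mono)
  then show ?thesis by simp
qed

text \<open>The fraction \<open>frac x \<one>\<close> is a regular sequence of length one: if it
  kills \<open>frac a s\<close>, then some denominator \<open>u\<close> satisfies
  \<open>x \<otimes> (u \<otimes> a) = \<zero>\<close>, so \<open>u \<otimes> a\<close> vanishes and
  with it the fraction.\<close>

lemma depth_localization_pos:
  assumes x: "x \<in> I" and reg: "\<And>a. a \<in> carrier R \<Longrightarrow> x \<otimes> a = \<zero> \<Longrightarrow> a = \<zero>"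
  shows "1 \<le> depth loc (localization_maximal R I)"
proof -
  interpret L: cring loc by (rule cring_localization)
  note one = denominators_one
  have xc: "x \<in> carrier R" using x Icarr by simp
  have max: "localization_maximal R I = extension I"
    unfolding localization_maximal_def extension_def ..
  interpret M: primeideal "extension I" loc by (rule extension_prime[OF primeideal subset_refl])
  let ?x = "frac x \<one>"
  have xM: "?x \<in> extension I"
    using frac_in_extension_iff[OF primeideal subset_refl xc one] x by simp
  have "regular_sequence loc [?x]"
    unfolding regular_sequence_def
  proof (intro conjI allI impI ballI)
    show "set [?x] \<subseteq> carrier loc" using frac_in_loc[OF xc one] by simp
    have "Idl\<^bsub>loc\<^esub> {?x} \<subseteq> extension I" using L.genideal_minimal[OF M.ideal_axioms] xM by simp
    moreover have "extension I \<noteq> carrier loc" using M.I_notcarr by simp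
    moreover have "extension I \<subseteq> carrier loc" using M.Icarr by auto
    ultimately show "Idl\<^bsub>loc\<^esub> (set [?x]) \<noteq> carrier loc" by auto
  next
    fix i y assume i: "i < length [?x]" and y: "y \<in> carrier loc"
      and z: "[?x] ! i \<otimes>\<^bsub>loc\<^esub> y \<in> Idl\<^bsub>loc\<^esub> (set (take i [?x]))"
    have empty: "Idl\<^bsub>loc\<^esub> {} = {\<zero>\<^bsub>loc\<^esub>}"
    proof
      show "Idl\<^bsub>loc\<^esub> {} \<subseteq> {\<zero>\<^bsub>loc\<^esub>}" using L.genideal_minimal[OF L.zeroideal] by simp
      show "{\<zero>\<^bsub>loc\<^esub>} \<subseteq> Idl\<^bsub>loc\<^esub> {}"
        using additive_subgroup.zero_closed[OF ideal.axioms(1)[OF L.genideal_ideal[of "{}"]]] by simp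
    qed
    obtain a s where a: "a \<in> carrier R" "s \<in> denominators" "y = frac a s"
      using y by (elim loc_cases)
    have sc: "s \<in> carrier R" using a by simp
    have "frac (x \<otimes> a) (\<one> \<otimes> s) = frac \<zero> \<one>"
      using z i empty loc_mult[OF xc one a(1,2)] a(3) loc_zero by simp
    then obtain u where u: "u \<in> denominators" "u \<otimes> (x \<otimes> a \<otimes> \<one>) = u \<otimes> (\<zero> \<otimes> (\<one> \<otimes> s))"
      using frac_eq_iff[of "x \<otimes> a" "\<one> \<otimes> s" \<zero> \<one>] xc a one denominators_mult[OF one a(2)] by auto
    then have "x \<otimes> (u \<otimes> a) = \<zero>" using xc a sc by (simp add: m_lcomm)
    then have "u \<otimes> a = \<zero>" using reg[of "u \<otimes> a"] u a by simp
    then have "frac a s = frac \<zero> \<one>"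
      unfolding frac_eq_iff[OF a(1,2) zero_closed one] using a sc u(1)
      by (intro bexI[OF _ u(1)]) simp
    then show "y \<in> Idl\<^bsub>loc\<^esub> (set (take i [?x]))"
      using i empty a(3) loc_zero by simp
  qed
  then have "enat (length [?x]) \<le> depth loc (localization_maximal R I)"
    unfolding depth_def max using xM by (intro Sup_upper CollectI exI[of _ "[?x]"]) auto
  then show ?thesis by (simp add: one_enat_def)
qed

text \<open>The fraction \<open>frac a \<one>\<close> is killed by the whole maximal ideal, yet it
  is nonzero because no denominator kills \<open>a\<close>. So no element of the maximal ideal can
  begin a regular sequence.\<close>

lemma depth_localization_annihilator:
  assumes a: "a \<in> carrier R" and ann: "I = annihilator R a"
  shows "\<not> 1 \<le> depth loc (localization_maximal R I)"
proof
  interpret L: cring loc by (rule cring_localization)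
  note one = denominators_one
  assume "1 \<le> depth loc (localization_maximal R I)"
  then have "\<exists>xs. regular_sequence loc xs \<and> set xs \<subseteq> localization_maximal R I \<and> xs \<noteq> []"
  proof (rule contrapos_pp)
    assume "\<not> (\<exists>xs. regular_sequence loc xs \<and> set xs \<subseteq> localization_maximal R I \<and> xs \<noteq> [])"
    then have "{enat (length xs) |xs. regular_sequence loc xs \<and> set xs \<subseteq> localization_maximal R I}
        \<subseteq> {0}" by (auto simp: zero_enat_def)
    then have "depth loc (localization_maximal R I) \<le> Sup {0}"
      unfolding depth_def by (rule Sup_subset_mono)
    then show "\<not> 1 \<le> depth loc (localization_maximal R I)" by simp
  qed
  then obtain y ys where ys: "regular_sequence loc (y # ys)"
      "set (y # ys) \<subseteq> localization_maximal R I"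
    by (metis neq_Nil_conv)
  then obtain x s where x: "x \<in> I" "s \<in> denominators" "y = frac x s"
    unfolding localization_maximal_def by auto
  have xc: "x \<in> carrier R" and sc: "s \<in> carrier R" using x Icarr by auto
  have "x \<in> annihilator R a" using x(1) by (simp only: ann)
  then have "x \<otimes> a = \<zero>" by (simp add: annihilator_def)
  then have "y \<otimes>\<^bsub>loc\<^esub> frac a \<one> = frac \<zero> (s \<otimes> \<one>)"
    using loc_mult[OF xc x(2) a one] x(3) by simp
  also have "\<dots> = \<zero>\<^bsub>loc\<^esub>"
    unfolding loc_zero using x(2) sc one by (intro frac_eqI) simp_all
  finally have "y \<otimes>\<^bsub>loc\<^esub> frac a \<one> \<in> Idl\<^bsub>loc\<^esub> (set (take 0 (y # ys)))"
    using additive_subgroup.zero_closed[OF ideal.axioms(1)[OF L.genideal_ideal[of "{}"]]] by simp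
  then have "frac a \<one> \<in> Idl\<^bsub>loc\<^esub> {}"
    using ys(1) frac_in_loc[OF a one] unfolding regular_sequence_def by fastforce
  then have "frac a \<one> = frac \<zero> \<one>"
    using L.genideal_minimal[OF L.zeroideal, of "{}"] loc_zero by auto
  then obtain u where u: "u \<in> denominators" "u \<otimes> (a \<otimes> \<one>) = u \<otimes> (\<zero> \<otimes> \<one>)"
    using frac_eq_iff[OF a one zero_closed one] by auto
  then have "u \<in> annihilator R a" using a by (simp add: annihilator_def)
  then show False using ann u by simp
qed

end

text \<open>The use of S_1 as a hypothesis. A smaller prime would make the localization
  positive-dimensional, and S_1 would then demand positive depth where the maximal ideal kills a
  nonzero element.\<close>

lemma (in cring) serre_1_annihilator_minimal:
  assumes S: "serre_condition 1 R" and a: "a \<in> carrier R"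
    and prime: "primeideal (annihilator R a) R"
  shows "minimal_prime R (annihilator R a)"
proof (rule ccontr)
  interpret P: primeideal "annihilator R a" R by (rule prime)
  assume "\<not> minimal_prime R (annihilator R a)"
  then obtain Q where "primeideal Q R" "Q \<subset> annihilator R a"
    using prime unfolding minimal_prime_def by auto
  then have "1 \<le> krull_dim P.loc" by (rule P.krull_dim_localization_pos)
  then have "1 \<le> depth P.loc (localization_maximal R (annihilator R a))"
    using S prime unfolding serre_condition_def
    by (metis min.absorb1 one_enat_def)
  then show False using P.depth_localization_annihilator[OF a] by simp
qed

text \<open>The use of S_1 as a goal. At a minimal prime the dimension is zero and the inequality is
  trivial; elsewhere a nonzerodivisor in the prime gives depth at least one.\<close>

lemma (in cring) serre_1I:
  assumes "\<And>P. primeideal P R \<Longrightarrow> \<not> minimal_prime R P \<Longrightarrow>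
    \<exists>x\<in>P. \<forall>a\<in>carrier R. x \<otimes> a = \<zero> \<longrightarrow> a = \<zero>"
  shows "serre_condition 1 R"
  unfolding serre_condition_def
proof (intro allI impI)
  fix P assume P: "primeideal P R"
  then interpret P: primeideal P R .
  show "min (enat 1) (krull_dim P.loc) \<le> depth P.loc (localization_maximal R P)"
  proof (cases "minimal_prime R P")
    case True
    then show ?thesis using P.krull_dim_localization_minimal by simp
  next
    case False
    obtain x where x: "x \<in> P" "\<forall>a\<in>carrier R. x \<otimes> a = \<zero> \<longrightarrow> a = \<zero>"
      using assms[OF P False] by auto
    have "1 \<le> depth P.loc (localization_maximal R P)"
      by (rule P.depth_localization_pos[OF x(1)]) (use x(2) in simp)
    then show ?thesis by (simp add: one_enat_def min.coboundedI1)
  qed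
qed

section \<open>Hilbert's basis theorem for subrings\<close>

text \<open>The combinatorial core of the basis theorem, with \<open>d\<close> for the degree and
  \<open>k\<close> for the place in a sequence of ideals. Once the diagonal is stable from
  \<open>k0\<close> on, its value bounds all rows from \<open>k0\<close> upwards; only finitely many
  rows remain, each with its own index of stability.\<close>

lemma doubly_increasing_stable:
  fixes L :: "nat \<Rightarrow> nat \<Rightarrow> 'a set"
  assumes m1: "\<And>d k. L d k \<subseteq> L (Suc d) k" and m2: "\<And>d k. L d k \<subseteq> L d (Suc k)"
    and row: "\<And>d. \<exists>K. \<forall>k\<ge>K. L d k = L d K"
    and diag: "\<exists>K. \<forall>k\<ge>K. L k k = L K K"
  shows "\<exists>K. \<forall>d. \<forall>k\<ge>K. L d k \<subseteq> L d K"
proof -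
  have mono1: "L d k \<subseteq> L d' k" if "d \<le> d'" for d d' k
    using lift_Suc_mono_le[of "\<lambda>d. L d k", OF m1 that] .
  have mono2: "L d k \<subseteq> L d k'" if "k \<le> k'" for d k k'
    using lift_Suc_mono_le[of "L d", OF m2 that] .
  obtain k0 where k0: "\<forall>k\<ge>k0. L k k = L k0 k0" using diag ..
  have "\<forall>d. \<exists>K. \<forall>k\<ge>K. L d k = L d K" using row by simp
  then obtain f where f: "\<forall>d. \<forall>k\<ge>f d. L d k = L d (f d)" by (rule exE[OF choice])
  \<comment> \<open>The sum is a convenient common upper bound of \<open>k0\<close> and all
    \<open>f d\<close> with \<open>d < k0\<close>, valid also when there is no such
    \<open>d\<close>.\<close>
  define K where "K = k0 + (\<Sum>d<k0. f d)"
  have "L d k \<subseteq> L d K" if k: "K \<le> k" for d k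
  proof (cases "d < k0")
    case True
    then have "f d \<le> (\<Sum>d<k0. f d)" by (intro member_le_sum) simp_all
    then have "f d \<le> K" unfolding K_def by simp
    moreover have "L d k = L d (f d)" by (rule f[rule_format]) (use \<open>f d \<le> K\<close> k in simp)
    ultimately show ?thesis using mono2[of "f d" K d] by simp
  next
    case False
    have "L d k \<subseteq> L (max d k) (max d k)"
      using mono1[of d "max d k" k] mono2[of k "max d k" "max d k"] by simp
    also have "\<dots> = L k0 k0" by (rule k0[rule_format]) (use False in simp)
    also have "\<dots> \<subseteq> L d K"
      using mono1[of k0 d k0] mono2[of k0 K d] False unfolding K_def by auto
    finally show ?thesis .
  qed
  then show ?thesis by blast
qed

text \<open>Values at \<open>x\<close> of polynomials over \<open>A\<close> of degree below
  \<open>n\<close>, so that \<open>adjoin\<close> is the subring \<open>A[x]\<close>. Working with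
  values inside a fixed ring, and not with polynomial rings, keeps the type of elements unchanged
  when generators are adjoined one after another.\<close>

primrec polys_below :: "('a, 'b) ring_scheme \<Rightarrow> 'a set \<Rightarrow> 'a \<Rightarrow> nat \<Rightarrow> 'a set" where
  "polys_below R A x 0 = {\<zero>\<^bsub>R\<^esub>}"
| "polys_below R A x (Suc n) =
    {p \<oplus>\<^bsub>R\<^esub> a \<otimes>\<^bsub>R\<^esub> x [^]\<^bsub>R\<^esub> n |p a. p \<in> polys_below R A x n \<and> a \<in> A}"

definition adjoin :: "('a, 'b) ring_scheme \<Rightarrow> 'a set \<Rightarrow> 'a \<Rightarrow> 'a set" where
  "adjoin R A x = (\<Union>n. polys_below R A x n)"

context cring
begin

text \<open>Negation is multiplication by minus one, which lies in \<open>H\<close>; the criterion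
  that remains mentions only operations of the ambient ring.\<close>

lemma ideal_subring_iff:
  assumes H: "subring H R"
  shows "ideal J (R\<lparr>carrier := H\<rparr>) \<longleftrightarrow> J \<subseteq> H \<and> \<zero> \<in> J \<and>
    (\<forall>x\<in>J. \<forall>y\<in>J. x \<oplus> y \<in> J) \<and> (\<forall>x\<in>J. \<forall>h\<in>H. h \<otimes> x \<in> J)" (is "?L \<longleftrightarrow> ?R")
proof
  assume ?L
  then interpret J: ideal J "R\<lparr>carrier := H\<rparr>" .
  show ?R
    using J.a_subset J.I_l_closed additive_subgroup.zero_closed[OF J.additive_subgroup_axioms]
      additive_subgroup.a_closed[OF J.additive_subgroup_axioms] by simp
next
  assume r: ?R
  interpret H: ring "R\<lparr>carrier := H\<rparr>" by (rule subring_is_ring[OF H])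
  have HR: "H \<subseteq> carrier R" using subringE(1)[OF H] .
  show ?L
  proof (rule idealI[OF H.ring_axioms])
    show "subgroup J (add_monoid (R\<lparr>carrier := H\<rparr>))"
    proof (rule H.add.subgroupI)
      fix a assume a: "a \<in> J"
      then have aH: "a \<in> H" using r by auto
      have "(\<ominus>\<^bsub>R\<lparr>carrier := H\<rparr>\<^esub> \<one>) \<in> H" using H.a_inv_closed[OF H.one_closed] by simp
      then have "(\<ominus>\<^bsub>R\<lparr>carrier := H\<rparr>\<^esub> \<one>) \<otimes> a \<in> J" using r a by simp
      then show "\<ominus>\<^bsub>R\<lparr>carrier := H\<rparr>\<^esub> a \<in> J"
        using H.l_minus[OF H.one_closed, of a] H.l_one[of a] aH by simp
    qed (use r in auto)
  next
    fix a x assume a: "a \<in> J" and x: "x \<in> carrier (R\<lparr>carrier := H\<rparr>)"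
    then have l: "x \<otimes> a \<in> J" using r by simp
    then show "x \<otimes>\<^bsub>R\<lparr>carrier := H\<rparr>\<^esub> a \<in> J" by simp
    have "a \<otimes> x = x \<otimes> a" using a x r HR by (intro m_comm) auto
    then show "a \<otimes>\<^bsub>R\<lparr>carrier := H\<rparr>\<^esub> x \<in> J" using l by simp
  qed
qed

context
  fixes A x
  assumes A: "subring A R" and x: "x \<in> carrier R"
begin

abbreviation pb where "pb \<equiv> polys_below R A x"

lemma subring_mem_carrier: "a \<in> A \<Longrightarrow> a \<in> carrier R"
  using subringE(1)[OF A] by auto

lemma polys_below_carrier: "p \<in> pb n \<Longrightarrow> p \<in> carrier R"
  by (induction n arbitrary: p) (auto simp: subring_mem_carrier x)

lemma polys_below_SucI: "p \<in> pb n \<Longrightarrow> a \<in> A \<Longrightarrow> p \<oplus> a \<otimes> x [^] n \<in> pb (Suc n)"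
  by auto

lemma polys_below_Suc: "p \<in> pb n \<Longrightarrow> p \<in> pb (Suc n)"
  using polys_below_SucI[of p n \<zero>] polys_below_carrier[of p n] subringE(2)[OF A] x by simp

lemma polys_below_mono: "n \<le> k \<Longrightarrow> p \<in> pb n \<Longrightarrow> p \<in> pb k"
  by (induction k rule: dec_induct) (auto simp del: polys_below.simps intro: polys_below_Suc)

lemma zero_polys_below: "\<zero> \<in> pb n"
  using polys_below_mono[of 0 n \<zero>] by simp

lemma polys_below_SucE:
  assumes "q \<in> pb (Suc n)"
  obtains p a where "p \<in> pb n" "p \<in> carrier R" "a \<in> A" "a \<in> carrier R" "q = p \<oplus> a \<otimes> x [^] n"
  using assms polys_below_carrier subring_mem_carrier by auto

lemma polys_below_add: "p \<in> pb n \<Longrightarrow> q \<in> pb n \<Longrightarrow> p \<oplus> q \<in> pb n"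
proof (induction n arbitrary: p q)
  case 0
  then show ?case by simp
next
  case (Suc n)
  obtain p' a where p: "p' \<in> pb n" "p' \<in> carrier R" "a \<in> A" "a \<in> carrier R" "p = p' \<oplus> a \<otimes> x [^] n"
    using Suc.prems(1) by (rule polys_below_SucE)
  obtain q' b where q: "q' \<in> pb n" "q' \<in> carrier R" "b \<in> A" "b \<in> carrier R" "q = q' \<oplus> b \<otimes> x [^] n"
    using Suc.prems(2) by (rule polys_below_SucE)
  have "p \<oplus> q = (p' \<oplus> q') \<oplus> (a \<oplus> b) \<otimes> x [^] n"
    using p q x by (simp add: l_distr a_ac)
  moreover have "a \<oplus> b \<in> A" using subringE(7)[OF A] p q by simp
  ultimately show ?case using polys_below_SucI[OF Suc.IH[OF p(1) q(1)]] by simp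
qed

lemma polys_below_smult: "p \<in> pb n \<Longrightarrow> c \<in> A \<Longrightarrow> c \<otimes> p \<in> pb n"
proof (induction n arbitrary: p)
  case 0
  then show ?case by (simp add: subring_mem_carrier)
next
  case (Suc n)
  obtain p' a where p: "p' \<in> pb n" "p' \<in> carrier R" "a \<in> A" "a \<in> carrier R" "p = p' \<oplus> a \<otimes> x [^] n"
    using Suc.prems(1) by (rule polys_below_SucE)
  have "c \<otimes> p = c \<otimes> p' \<oplus> (c \<otimes> a) \<otimes> x [^] n"
    using p subring_mem_carrier[OF Suc.prems(2)] x by (simp add: r_distr m_assoc)
  moreover have "c \<otimes> a \<in> A" using subringE(6)[OF A] p Suc.prems by simp
  ultimately show ?case using polys_below_SucI[OF Suc.IH[OF p(1) Suc.prems(2)]] by simp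
qed

lemma polys_below_shift: "p \<in> pb n \<Longrightarrow> x \<otimes> p \<in> pb (Suc n)"
proof (induction n arbitrary: p)
  case 0
  then show ?case using zero_polys_below[of "Suc 0"] x by simp
next
  case (Suc n)
  obtain p' a where p: "p' \<in> pb n" "p' \<in> carrier R" "a \<in> A" "a \<in> carrier R" "p = p' \<oplus> a \<otimes> x [^] n"
    using Suc.prems(1) by (rule polys_below_SucE)
  have "x \<otimes> p = x \<otimes> p' \<oplus> a \<otimes> x [^] Suc n"
    using p x by (simp add: r_distr m_ac)
  then show ?case using polys_below_SucI[OF Suc.IH[OF p(1)] p(3)] by simp
qed

lemma polys_below_subset_adjoin: "p \<in> pb n \<Longrightarrow> p \<in> adjoin R A x"
  unfolding adjoin_def by auto

lemma adjoinE:
  assumes "p \<in> adjoin R A x"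
  obtains n where "p \<in> pb n"
  using assms unfolding adjoin_def by auto

lemma adjoin_carrier: "p \<in> adjoin R A x \<Longrightarrow> p \<in> carrier R"
  by (elim adjoinE) (rule polys_below_carrier)

lemma subset_adjoin: "a \<in> A \<Longrightarrow> a \<in> adjoin R A x"
  using polys_below_SucI[OF zero_polys_below[of 0], of a] polys_below_subset_adjoin[of a "Suc 0"] subring_mem_carrier[of a] by simp

lemma power_shift_adjoin: "p \<in> adjoin R A x \<Longrightarrow> x [^] (n::nat) \<otimes> p \<in> adjoin R A x"
proof (induction n)
  case 0
  then show ?case using adjoin_carrier by simp
next
  case (Suc n)
  obtain k where "x [^] n \<otimes> p \<in> pb k" using Suc.IH[OF Suc.prems] by (rule adjoinE)
  then have "x \<otimes> (x [^] n \<otimes> p) \<in> adjoin R A x" by (intro polys_below_subset_adjoin[OF polys_below_shift])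
  then show ?case using x adjoin_carrier[OF Suc.prems] by (simp add: m_ac)
qed

lemma element_in_adjoin: "x \<in> adjoin R A x"
  using power_shift_adjoin[OF subset_adjoin[OF subringE(3)[OF A]], of 1] x by simp

lemma adjoin_add: "p \<in> adjoin R A x \<Longrightarrow> q \<in> adjoin R A x \<Longrightarrow> p \<oplus> q \<in> adjoin R A x"
proof -
  assume "p \<in> adjoin R A x" "q \<in> adjoin R A x"
  then obtain n k where "p \<in> pb n" "q \<in> pb k" by (elim adjoinE)
  then have "p \<oplus> q \<in> pb (max n k)" by (intro polys_below_add polys_below_mono[of n "max n k"] polys_below_mono[of k "max n k"]) auto
  then show "p \<oplus> q \<in> adjoin R A x" by (rule polys_below_subset_adjoin)
qed

lemma adjoin_smult: "c \<in> A \<Longrightarrow> p \<in> adjoin R A x \<Longrightarrow> c \<otimes> p \<in> adjoin R A x"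
  by (elim adjoinE) (rule polys_below_subset_adjoin[OF polys_below_smult])

lemma adjoin_mult:
  assumes q: "q \<in> adjoin R A x"
  shows "p \<in> adjoin R A x \<Longrightarrow> p \<otimes> q \<in> adjoin R A x"
proof (elim adjoinE)
  fix n show "p \<in> pb n \<Longrightarrow> p \<otimes> q \<in> adjoin R A x"
  proof (induction n arbitrary: p)
    case 0
    then show ?case using subset_adjoin[OF subringE(2)[OF A]] adjoin_carrier[OF q] by simp
  next
    case (Suc n)
    obtain p' a where p: "p' \<in> pb n" "p' \<in> carrier R" "a \<in> A" "a \<in> carrier R" "p = p' \<oplus> a \<otimes> x [^] n"
      using Suc.prems(1) by (rule polys_below_SucE)
    have "p \<otimes> q = p' \<otimes> q \<oplus> a \<otimes> (x [^] n \<otimes> q)"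
      using p x adjoin_carrier[OF q] by (simp add: l_distr m_assoc)
    then show ?case
      using adjoin_add[OF Suc.IH[OF p(1)] adjoin_smult[OF p(3) power_shift_adjoin[OF q]]] by simp
  qed
qed

lemma subring_adjoin: "subring (adjoin R A x) R"
proof (rule subringI)
  fix h assume h: "h \<in> adjoin R A x"
  have "\<ominus> \<one> \<in> A" using subringE(3,5)[OF A] by simp
  then have "(\<ominus> \<one>) \<otimes> h \<in> adjoin R A x" using adjoin_smult h by simp
  then show "\<ominus> h \<in> adjoin R A x" using adjoin_carrier[OF h] by (simp add: l_minus)
qed (use adjoin_carrier adjoin_mult adjoin_add subset_adjoin[OF subringE(3)[OF A]] in auto)

definition leading_coeffs :: "nat \<Rightarrow> 'a set \<Rightarrow> 'a set" where
  "leading_coeffs d J = {c \<in> A. \<exists>p\<in>pb d. p \<oplus> c \<otimes> x [^] d \<in> J}"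

lemma ideal_leading_coeffs:
  assumes J: "ideal J (R\<lparr>carrier := adjoin R A x\<rparr>)"
  shows "ideal (leading_coeffs d J) (R\<lparr>carrier := A\<rparr>)"
    and "leading_coeffs d J \<subseteq> leading_coeffs (Suc d) J"
proof -
  have z: "\<zero> \<in> J" and add: "\<And>u v. u \<in> J \<Longrightarrow> v \<in> J \<Longrightarrow> u \<oplus> v \<in> J"
    and mult: "\<And>u h. u \<in> J \<Longrightarrow> h \<in> adjoin R A x \<Longrightarrow> h \<otimes> u \<in> J"
    using J unfolding ideal_subring_iff[OF subring_adjoin] by auto
  show "ideal (leading_coeffs d J) (R\<lparr>carrier := A\<rparr>)"
    unfolding ideal_subring_iff[OF A]
  proof (intro conjI ballI)
    show "leading_coeffs d J \<subseteq> A" unfolding leading_coeffs_def by auto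
    show "\<zero> \<in> leading_coeffs d J"
      unfolding leading_coeffs_def using subringE(2)[OF A] z zero_polys_below x
      by (intro CollectI conjI bexI[of _ \<zero>]) auto
  next
    fix b c assume "b \<in> leading_coeffs d J" "c \<in> leading_coeffs d J"
    then obtain p q where h: "b \<in> A" "c \<in> A" "p \<in> pb d" "q \<in> pb d"
      "p \<oplus> b \<otimes> x [^] d \<in> J" "q \<oplus> c \<otimes> x [^] d \<in> J" unfolding leading_coeffs_def by auto
    have "(p \<oplus> q) \<oplus> (b \<oplus> c) \<otimes> x [^] d = (p \<oplus> b \<otimes> x [^] d) \<oplus> (q \<oplus> c \<otimes> x [^] d)"
      using h(1,2)[THEN subring_mem_carrier] h(3,4)[THEN polys_below_carrier] x by (simp add: l_distr a_ac)
    then have "(p \<oplus> q) \<oplus> (b \<oplus> c) \<otimes> x [^] d \<in> J" using add h(5,6) by simp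
    then show "b \<oplus> c \<in> leading_coeffs d J"
      unfolding leading_coeffs_def using polys_below_add[OF h(3,4)] subringE(7)[OF A h(1,2)] by auto
  next
    fix b c assume "b \<in> leading_coeffs d J" and c: "c \<in> A"
    then obtain p where h: "b \<in> A" "p \<in> pb d" "p \<oplus> b \<otimes> x [^] d \<in> J"
      unfolding leading_coeffs_def by auto
    have "c \<otimes> p \<oplus> (c \<otimes> b) \<otimes> x [^] d = c \<otimes> (p \<oplus> b \<otimes> x [^] d)"
      using subring_mem_carrier[OF c] subring_mem_carrier[OF h(1)] polys_below_carrier[OF h(2)] x by (simp add: r_distr m_assoc)
    then have "c \<otimes> p \<oplus> (c \<otimes> b) \<otimes> x [^] d \<in> J" using mult[OF h(3) subset_adjoin[OF c]] by simp
    then show "c \<otimes> b \<in> leading_coeffs d J"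
      unfolding leading_coeffs_def using polys_below_smult[OF h(2) c] subringE(6)[OF A c h(1)] by auto
  qed
  show "leading_coeffs d J \<subseteq> leading_coeffs (Suc d) J"
  proof
    fix b assume "b \<in> leading_coeffs d J"
    then obtain p where h: "b \<in> A" "p \<in> pb d" "p \<oplus> b \<otimes> x [^] d \<in> J"
      unfolding leading_coeffs_def by auto
    have "x \<otimes> p \<oplus> b \<otimes> x [^] Suc d = x \<otimes> (p \<oplus> b \<otimes> x [^] d)"
      using subring_mem_carrier[OF h(1)] polys_below_carrier[OF h(2)] x by (simp add: r_distr m_ac)
    then have "x \<otimes> p \<oplus> b \<otimes> x [^] Suc d \<in> J" using mult[OF h(3) element_in_adjoin] by simp
    then show "b \<in> leading_coeffs (Suc d) J"
      unfolding leading_coeffs_def using polys_below_shift[OF h(2)] h(1) by blast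
  qed
qed

text \<open>Induction on the degree bound of an expression for an element of \<open>K\<close>: some
  element of \<open>J\<close> has an expression with the same leading term, and the difference is in
  \<open>K\<close> with a smaller bound.\<close>

lemma leading_coeffs_determine:
  assumes J: "ideal J (R\<lparr>carrier := adjoin R A x\<rparr>)" and K: "ideal K (R\<lparr>carrier := adjoin R A x\<rparr>)"
    and JK: "J \<subseteq> K" and lead: "\<And>d. leading_coeffs d K \<subseteq> leading_coeffs d J"
  shows "K \<subseteq> J"
proof
  have J': "\<zero> \<in> J" "\<And>u v. u \<in> J \<Longrightarrow> v \<in> J \<Longrightarrow> u \<oplus> v \<in> J"
    using J unfolding ideal_subring_iff[OF subring_adjoin] by auto
  have K': "K \<subseteq> adjoin R A x" "\<And>u v. u \<in> K \<Longrightarrow> v \<in> K \<Longrightarrow> u \<oplus> v \<in> K"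
      "\<And>u h. u \<in> K \<Longrightarrow> h \<in> adjoin R A x \<Longrightarrow> h \<otimes> u \<in> K"
    using K unfolding ideal_subring_iff[OF subring_adjoin] by auto
  have m1: "\<ominus> \<one> \<in> A" using subringE(3,5)[OF A] by simp
  have "f \<in> K \<Longrightarrow> f \<in> pb n \<Longrightarrow> f \<in> J" for f n
  proof (induction n arbitrary: f)
    case 0
    then show ?case using J' by simp
  next
    case (Suc n)
    obtain p c where p: "p \<in> pb n" "p \<in> carrier R" "c \<in> A" "c \<in> carrier R" "f = p \<oplus> c \<otimes> x [^] n"
      using Suc.prems(2) by (rule polys_below_SucE)
    have "c \<in> leading_coeffs n K" unfolding leading_coeffs_def using p Suc.prems by auto
    then have "c \<in> leading_coeffs n J" using lead by auto
    then obtain q where q: "q \<in> pb n" "q \<oplus> c \<otimes> x [^] n \<in> J" unfolding leading_coeffs_def by auto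
    let ?g = "q \<oplus> c \<otimes> x [^] n"
    have c: "q \<in> carrier R" "?g \<in> carrier R" "f \<in> carrier R" using polys_below_carrier[OF q(1)] p x by auto
    \<comment> \<open>The difference is written with the factor minus one because closure of
      \<open>K\<close> and of \<open>pb n\<close> is available for sums and for multiples by
      elements of the subring.\<close>
    have eq: "f \<oplus> (\<ominus> \<one>) \<otimes> ?g = p \<oplus> (\<ominus> \<one>) \<otimes> q"
    proof -
      have "f \<oplus> (\<ominus> \<one>) \<otimes> ?g = p \<oplus> c \<otimes> x [^] n \<ominus> (q \<oplus> c \<otimes> x [^] n)"
        using c p(5) by (simp add: l_minus a_minus_def)
      also have "\<dots> = p \<ominus> q" using c p(2,4) x by (simp add: a_minus_def minus_add a_ac r_neg r_neg1 r_neg2)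
      finally show ?thesis using c by (simp add: l_minus a_minus_def)
    qed
    have "?g \<in> K" using q(2) JK by auto
    then have "f \<oplus> (\<ominus> \<one>) \<otimes> ?g \<in> K"
      using K'(2)[OF Suc.prems(1) K'(3)[OF _ subset_adjoin[OF m1]]] by simp
    moreover have "p \<oplus> (\<ominus> \<one>) \<otimes> q \<in> pb n" by (intro polys_below_add p polys_below_smult q m1)
    ultimately have "f \<oplus> (\<ominus> \<one>) \<otimes> ?g \<in> J" using Suc.IH eq by simp
    then have "(f \<oplus> (\<ominus> \<one>) \<otimes> ?g) \<oplus> ?g \<in> J" using J'(2) q(2) by simp
    moreover have "(f \<oplus> (\<ominus> \<one>) \<otimes> ?g) \<oplus> ?g = f"
      using c by (simp add: l_minus a_assoc l_neg)
    ultimately show ?case by simp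
  qed
  moreover fix f assume "f \<in> K"
  ultimately show "f \<in> J" using K'(1) by (meson adjoinE subsetD)
qed

text \<open>Hilbert's argument: the ideals of leading coefficients grow with the degree (multiply by
  \<open>x\<close>) and along the sequence, so they become stable at an index common to all degrees,
  and they determine the ideals of \<open>A[x]\<close> above.\<close>

theorem noetherian_adjoin:
  assumes N: "noetherian_ring (R\<lparr>carrier := A\<rparr>)"
  shows "noetherian_ring (R\<lparr>carrier := adjoin R A x\<rparr>)"
proof -
  interpret WA: ring "R\<lparr>carrier := A\<rparr>" by (rule subring_is_ring[OF A])
  interpret T: ring "R\<lparr>carrier := adjoin R A x\<rparr>" by (rule subring_is_ring[OF subring_adjoin])
  show ?thesis
    unfolding T.noetherian_iff_stable
  proof (intro allI impI)
    fix \<aa> :: "nat \<Rightarrow> 'a set"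
    assume h: "\<forall>k. ideal (\<aa> k) (R\<lparr>carrier := adjoin R A x\<rparr>) \<and> \<aa> k \<subseteq> \<aa> (Suc k)"
    have id: "ideal (\<aa> k) (R\<lparr>carrier := adjoin R A x\<rparr>)" for k using spec[OF h, of k] ..
    have inc: "\<aa> k \<subseteq> \<aa> (Suc k)" for k using spec[OF h, of k] ..
    define L where "L d k = leading_coeffs d (\<aa> k)" for d k
    have L: "ideal (L d k) (R\<lparr>carrier := A\<rparr>)" "L d k \<subseteq> L (Suc d) k" "L d k \<subseteq> L d (Suc k)" for d k
      unfolding L_def using ideal_leading_coeffs[OF id] inc[of k]
      by (auto simp: leading_coeffs_def)
    note stable = N[unfolded WA.noetherian_iff_stable, THEN spec, THEN mp]
    have row: "\<exists>K. \<forall>k\<ge>K. L d k = L d K" for d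
      using stable[of "L d"] L by simp
    have "L k k \<subseteq> L (Suc k) (Suc k)" for k
      using L(2)[of k k] L(3)[of "Suc k" k] by (rule subset_trans)
    then have diag: "\<exists>K. \<forall>k\<ge>K. L k k = L K K"
      using stable[of "\<lambda>k. L k k"] L(1) by simp
    obtain K where K: "\<forall>d. \<forall>k\<ge>K. L d k \<subseteq> L d K"
      using doubly_increasing_stable[OF L(2,3) row diag] ..
    have "\<aa> k = \<aa> K" if k: "K \<le> k" for k
    proof
      show le: "\<aa> K \<subseteq> \<aa> k" by (rule lift_Suc_mono_le[of \<aa>, OF inc k])
      have "leading_coeffs d (\<aa> k) \<subseteq> leading_coeffs d (\<aa> K)" for d
        using K[rule_format, OF k, of d] unfolding L_def .
      then show "\<aa> k \<subseteq> \<aa> K" by (rule leading_coeffs_determine[OF id id le])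
    qed
    then show "\<exists>K. \<forall>k\<ge>K. \<aa> k = \<aa> K" by (intro exI[of _ K] allI impI)
  qed
qed

end

text \<open>The generators are adjoined one at a time. Generation is expressed by the subrings
  containing \<open>A\<close> and \<open>S\<close>, so the resulting subring \<open>B\<close> is the
  whole ring without any description of its elements.\<close>

theorem noetherian_finitely_generated:
  assumes A: "subring A R" "noetherian_ring (R\<lparr>carrier := A\<rparr>)"
    and S: "finite S" "S \<subseteq> carrier R"
    and gen: "\<And>B. subring B R \<Longrightarrow> A \<subseteq> B \<Longrightarrow> S \<subseteq> B \<Longrightarrow> carrier R \<subseteq> B"
  shows "noetherian_ring R"
proof -
  have "\<exists>B. subring B R \<and> noetherian_ring (R\<lparr>carrier := B\<rparr>) \<and> A \<subseteq> B \<and> S \<subseteq> B"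
    using S
  proof (induction S)
    case empty
    then show ?case using A by auto
  next
    case (insert x S)
    then obtain B where B: "subring B R" "noetherian_ring (R\<lparr>carrier := B\<rparr>)" "A \<subseteq> B" "S \<subseteq> B"
      by auto
    have x: "x \<in> carrier R" using insert by auto
    show ?case
      using subring_adjoin[OF B(1) x] noetherian_adjoin[OF B(1) x B(2)]
        subset_adjoin[OF B(1) x] element_in_adjoin[OF B(1) x] B(3,4)
      by (intro exI[of _ "adjoin R B x"]) auto
  qed
  then obtain B where B: "subring B R" "noetherian_ring (R\<lparr>carrier := B\<rparr>)" "A \<subseteq> B" "S \<subseteq> B"
    by auto
  then have "B = carrier R" using gen[OF B(1,3,4)] subringE(1)[OF B(1)] by (intro subset_antisym)
  then show ?thesis using B(2) by simp
qed

end

section \<open>The graded ring of a filtration\<close>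

text \<open>Both the powers of \<open>I\<close> and every m-th term of that sequence satisfy these
  axioms, so \<open>G\<close> and \<open>B\<close> are two instances of one construction over the
  same ring.\<close>

locale filtration = cring R for R (structure) +
  fixes F :: "nat \<Rightarrow> 'a set"
  assumes ideal_F: "ideal (F n) R"
    and F_0: "F 0 = carrier R"
    and F_Suc: "F (Suc n) \<subseteq> F n"
    and F_mult: "a \<in> F i \<Longrightarrow> b \<in> F j \<Longrightarrow> a \<otimes> b \<in> F (i + j)"
begin

abbreviation gr :: "(nat \<Rightarrow> 'a set) ring" where
  "gr \<equiv> graded_quotient R F (\<lambda>n. F (Suc n))"

text \<open>The Rees ring \<open>\<Oplus>n. F n t^n\<close>, as a set of polynomials over
  \<open>R\<close>. It provides representatives for elements of \<open>gr\<close>: arithmetic is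
  done in \<open>UP R\<close> and carried over by \<open>cls\<close>.\<close>

definition rees :: "(nat \<Rightarrow> 'a) set" where
  "rees = {p \<in> up R. \<forall>n. p n \<in> F n}"

definition cls :: "(nat \<Rightarrow> 'a) \<Rightarrow> nat \<Rightarrow> 'a set" where
  "cls p = (\<lambda>n. F (Suc n) +> p n)"

definition single :: "nat \<Rightarrow> 'a \<Rightarrow> nat \<Rightarrow> 'a" where
  "single n x = (\<lambda>i. if i = n then x else \<zero>)"

definition form :: "nat \<Rightarrow> 'a \<Rightarrow> nat \<Rightarrow> 'a set" where
  "form n x = cls (single n x)"

lemma F_carrier: "a \<in> F n \<Longrightarrow> a \<in> carrier R"
  using ideal.Icarr[OF ideal_F] .

lemma F_zero [simp]: "\<zero> \<in> F n"
  using additive_subgroup.zero_closed[OF ideal.axioms(1)[OF ideal_F]] .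

lemma F_add: "a \<in> F n \<Longrightarrow> b \<in> F n \<Longrightarrow> a \<oplus> b \<in> F n"
  using additive_subgroup.a_closed[OF ideal.axioms(1)[OF ideal_F]] .

lemma F_minus: "a \<in> F n \<Longrightarrow> \<ominus> a \<in> F n"
  using additive_subgroup.a_inv_closed[OF ideal.axioms(1)[OF ideal_F]] .

lemma F_antimono: "k \<le> n \<Longrightarrow> F n \<subseteq> F k"
  using lift_Suc_antimono_le[of F, OF F_Suc] .

lemma F_pow: "a \<in> F n \<Longrightarrow> a [^] (k::nat) \<in> F (n * k)"
proof (induction k)
  case 0
  then show ?case using F_0 by simp
next
  case (Suc k)
  then show ?case using F_mult[of "a [^] k" "n * k" a n] by (simp add: add.commute)
qed

lemma F_finsum:
  assumes "finite A" "\<And>i. i \<in> A \<Longrightarrow> f i \<in> F n"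
  shows "(\<Oplus>i\<in>A. f i) \<in> F n"
  using assms
proof (induction A)
  case (insert x A)
  have "f \<in> A \<rightarrow> carrier R" "f x \<in> carrier R" using insert.prems F_carrier by blast+
  then have "(\<Oplus>i\<in>insert x A. f i) = f x \<oplus> (\<Oplus>i\<in>A. f i)" using insert.hyps by simp
  then show ?case using insert.IH insert.prems F_add by simp
qed simp

lemma coset_eq_iff:
  "a \<in> carrier R \<Longrightarrow> b \<in> carrier R \<Longrightarrow> F n +> a = F n +> b \<longleftrightarrow> a \<ominus> b \<in> F n"
  using quotient_eq_iff_same_a_r_cos[OF ideal_F] by simp

lemma coset_zero_iff: "a \<in> carrier R \<Longrightarrow> F n +> a = F n \<longleftrightarrow> a \<in> F n"
  using a_rcos_zero[OF ideal_F] ideal.rcos_const_imp_mem[OF ideal_F] by auto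

text \<open>Moving the representatives by \<open>u\<close> and \<open>v\<close> changes the product
  by \<open>u \<otimes> v \<oplus> (u \<otimes> b \<oplus> a \<otimes> v)\<close>, whose terms all
  lie in \<open>F (Suc (i + j))\<close>. Hence the union in \<open>rcoset_mult\<close> runs over
  copies of a single coset.\<close>

lemma coset_mult:
  assumes a: "a \<in> F i" and b: "b \<in> F j"
  shows "rcoset_mult R (F (Suc (i + j))) (F (Suc i) +> a) (F (Suc j) +> b) = F (Suc (i + j)) +> (a \<otimes> b)"
proof -
  have eq: "F (Suc (i + j)) +> (a' \<otimes> b') = F (Suc (i + j)) +> (a \<otimes> b)"
    if m: "a' \<in> F (Suc i) +> a" "b' \<in> F (Suc j) +> b" for a' b'
  proof -
    obtain u v where uv: "u \<in> F (Suc i)" "a' = u \<oplus> a" "v \<in> F (Suc j)" "b' = v \<oplus> b"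
      using m by (auto simp: a_r_coset_def')
    have c: "a \<in> carrier R" "b \<in> carrier R" "u \<in> carrier R" "v \<in> carrier R"
      using a b uv F_carrier by auto
    have "u \<otimes> v \<in> F (Suc (i + j))"
      using F_mult[OF uv(1,3)] F_antimono[of "Suc (i + j)" "Suc i + Suc j"] by auto
    moreover have "u \<otimes> b \<in> F (Suc (i + j))" using F_mult[OF uv(1) b] by simp
    moreover have "a \<otimes> v \<in> F (Suc (i + j))" using F_mult[OF a uv(3)] by simp
    ultimately have "u \<otimes> v \<oplus> (u \<otimes> b \<oplus> a \<otimes> v) \<in> F (Suc (i + j))" using F_add by simp
    moreover have "a' \<otimes> b' \<ominus> a \<otimes> b = u \<otimes> v \<oplus> (u \<otimes> b \<oplus> a \<otimes> v)"
      unfolding uv using c by algebra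
    ultimately show ?thesis using coset_eq_iff[of "a' \<otimes> b'" "a \<otimes> b"] c uv by simp
  qed
  have mem: "x \<in> F n +> x" if "x \<in> carrier R" for x n
    using that by (auto simp: a_r_coset_def' intro!: bexI[of _ \<zero>])
  have "a \<in> F (Suc i) +> a" "b \<in> F (Suc j) +> b" using mem a b F_carrier by auto
  then have ne: "F (Suc i) +> a \<noteq> {}" "F (Suc j) +> b \<noteq> {}" by auto
  have "(\<Union>b'\<in>F (Suc j) +> b. F (Suc (i + j)) +> (a' \<otimes> b')) = F (Suc (i + j)) +> (a \<otimes> b)"
    if "a' \<in> F (Suc i) +> a" for a'
    by (rule SUP_eq_const[OF ne(2)]) (rule eq[OF that])
  then show ?thesis unfolding rcoset_mult_def by (rule SUP_eq_const[OF ne(1)])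
qed

lemma up_carrier: "p \<in> up R \<Longrightarrow> p n \<in> carrier R"
  by auto

lemma UP_carrier: "carrier (UP R) = up R"
  by (simp add: UP_def)

lemma UP_add: "p \<in> up R \<Longrightarrow> q \<in> up R \<Longrightarrow> p \<oplus>\<^bsub>UP R\<^esub> q = (\<lambda>n. p n \<oplus> q n)"
  by (simp add: UP_def)

lemma UP_mult:
  "p \<in> up R \<Longrightarrow> q \<in> up R \<Longrightarrow> p \<otimes>\<^bsub>UP R\<^esub> q = (\<lambda>n. \<Oplus>i\<in>{..n}. p i \<otimes> q (n - i))"
  by (simp add: UP_def)

lemma UP_coeff: "p \<in> up R \<Longrightarrow> up_ring.coeff (UP R) p n = p n"
  by (simp add: UP_def)

lemma UP_one: "\<one>\<^bsub>UP R\<^esub> = single 0 \<one>"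
  by (simp add: UP_def single_def)

lemma UP_zero: "\<zero>\<^bsub>UP R\<^esub> = (\<lambda>n. \<zero>)"
  by (simp add: UP_def)

lemma UP_monom: "x \<in> carrier R \<Longrightarrow> up_ring.monom (UP R) x n = single n x"
  by (simp add: UP_def single_def)

interpretation U: UP_cring R "UP R"
  by (rule UP_cring.intro) (rule is_cring)

lemma UP_minus:
  assumes "p \<in> up R"
  shows "\<ominus>\<^bsub>UP R\<^esub> p = (\<lambda>n. \<ominus> p n)"
proof -
  have m: "\<ominus>\<^bsub>UP R\<^esub> p \<in> up R" using U.UP_a_inv_closed[of p] assms by (simp add: UP_carrier)
  show ?thesis
  proof
    fix n show "(\<ominus>\<^bsub>UP R\<^esub> p) n = \<ominus> p n"
      using U.coeff_a_inv[of p n] UP_coeff[OF m] UP_coeff[OF assms] assms by (simp only: UP_carrier)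
  qed
qed

lemma single_up: "x \<in> carrier R \<Longrightarrow> single n x \<in> up R"
  using U.monom_closed[of x n] by (simp add: UP_carrier UP_monom)

lemma rees_up: "p \<in> rees \<Longrightarrow> p \<in> up R"
  by (simp add: rees_def)

lemma rees_F: "p \<in> rees \<Longrightarrow> p n \<in> F n"
  by (simp add: rees_def)

lemma single_rees: "x \<in> F n \<Longrightarrow> single n x \<in> rees"
  using single_up[OF F_carrier] by (auto simp: rees_def single_def)

lemma subring_rees: "subring rees (UP R)"
proof (rule U.P.subringI)
  show "rees \<subseteq> carrier (UP R)" using rees_up by (auto simp: UP_carrier)
  show "\<one>\<^bsub>UP R\<^esub> \<in> rees" unfolding UP_one by (rule single_rees) (simp add: F_0)
next
  fix p assume p: "p \<in> rees"
  have "\<ominus>\<^bsub>UP R\<^esub> p \<in> up R" using U.UP_a_inv_closed[of p] rees_up[OF p] by (simp add: UP_carrier)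
  then show "\<ominus>\<^bsub>UP R\<^esub> p \<in> rees"
    using rees_F[OF p] F_minus by (simp add: rees_def UP_minus[OF rees_up[OF p]])
next
  fix p q assume pq: "p \<in> rees" "q \<in> rees"
  note up = rees_up[OF pq(1)] rees_up[OF pq(2)]
  have c: "p \<otimes>\<^bsub>UP R\<^esub> q \<in> up R" "p \<oplus>\<^bsub>UP R\<^esub> q \<in> up R"
    using U.UP_mult_closed[of p q] U.UP_a_closed[of p q] up by (simp_all add: UP_carrier)
  have "p i \<otimes> q (n - i) \<in> F n" if "i \<in> {..n}" for i n
    using F_mult[OF rees_F[OF pq(1)] rees_F[OF pq(2)], of i "n - i"] that by simp
  then have "(\<Oplus>i\<in>{..n}. p i \<otimes> q (n - i)) \<in> F n" for n by (intro F_finsum) auto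
  then show "p \<otimes>\<^bsub>UP R\<^esub> q \<in> rees" using c(1) by (simp add: rees_def UP_mult[OF up])
  show "p \<oplus>\<^bsub>UP R\<^esub> q \<in> rees"
    using c(2) rees_F[OF pq(1)] rees_F[OF pq(2)] F_add by (simp add: rees_def UP_add[OF up])
qed

lemma cls_eq_iff:
  assumes "p \<in> rees" "q \<in> rees"
  shows "cls p = cls q \<longleftrightarrow> (\<forall>n. p n \<ominus> q n \<in> F (Suc n))"
  unfolding cls_def fun_eq_iff
  using coset_eq_iff[OF up_carrier[OF rees_up[OF assms(1)]] up_carrier[OF rees_up[OF assms(2)]]] by simp

lemma gr_zero: "\<zero>\<^bsub>gr\<^esub> = (\<lambda>n. F (Suc n))"
  by (simp add: graded_quotient_def)

lemma cls_zero_iff: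
  assumes "p \<in> rees"
  shows "cls p = \<zero>\<^bsub>gr\<^esub> \<longleftrightarrow> (\<forall>n. p n \<in> F (Suc n))"
  unfolding cls_def gr_zero fun_eq_iff using coset_zero_iff[OF up_carrier[OF rees_up[OF assms]]] by simp

lemma cls_zero: "cls (\<lambda>n. \<zero>) = \<zero>\<^bsub>gr\<^esub>"
  using coset_zero_iff[OF zero_closed] by (simp add: cls_def gr_zero)

lemma cls_closed:
  assumes p: "p \<in> rees"
  shows "cls p \<in> carrier gr"
proof -
  obtain N where N: "bound \<zero> N p" using rees_up[OF p] by auto
  have "{n. cls p n \<noteq> F (Suc n)} \<subseteq> {..N}"
  proof
    fix n assume n: "n \<in> {n. cls p n \<noteq> F (Suc n)}"
    have "F (Suc n) +> \<zero> = F (Suc n)" using coset_zero_iff[OF zero_closed] F_zero by simp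
    then have "p n \<noteq> \<zero>" using n unfolding cls_def mem_Collect_eq by metis
    then show "n \<in> {..N}" using bound_below[OF N] by simp
  qed
  then have "finite {n. cls p n \<noteq> F (Suc n)}" using finite_subset by blast
  then show ?thesis using rees_F[OF p] by (auto simp: graded_quotient_def cls_def)
qed

lemma gr_cases:
  assumes f: "f \<in> carrier gr"
  obtains p where "p \<in> rees" "f = cls p"
proof -
  have "\<forall>n. \<exists>a. a \<in> F n \<and> f n = F (Suc n) +> a" and fin: "finite {n. f n \<noteq> F (Suc n)}"
    using f by (auto simp: graded_quotient_def)
  from choice[OF this(1)] obtain a where "\<forall>n. a n \<in> F n \<and> f n = F (Suc n) +> a n" ..
  then have a: "a n \<in> F n" "f n = F (Suc n) +> a n" for n by simp_all
  \<comment> \<open>Zero represents every zero coset; this makes the support finite, so that the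
    representatives form a polynomial.\<close>
  define p where "p n = (if f n = F (Suc n) then \<zero> else a n)" for n
  have "\<exists>N. bound \<zero> N p"
  proof -
    obtain N where "\<forall>n\<in>{n. f n \<noteq> F (Suc n)}. n \<le> N" using finite_nat_set_iff_bounded_le[THEN iffD1, OF fin] ..
    then have "bound \<zero> N p" by (intro bound.intro) (auto simp: p_def not_le[symmetric])
    then show ?thesis ..
  qed
  moreover have "p n \<in> F n" for n using a(1) by (simp add: p_def)
  ultimately have "p \<in> rees" using F_carrier by (auto simp: rees_def intro!: mem_upI)
  moreover have "f = cls p"
  proof
    fix n show "f n = cls p n"
      using a(2)[of n] coset_zero_iff[OF zero_closed, of "Suc n"] by (auto simp: cls_def p_def)
  qed
  ultimately show thesis using that by simp
qed

lemma cls_add: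
  assumes "p \<in> rees" "q \<in> rees"
  shows "cls p \<oplus>\<^bsub>gr\<^esub> cls q = cls (p \<oplus>\<^bsub>UP R\<^esub> q)"
proof
  fix n
  have "F (Suc n) +> p n <+>\<^bsub>R\<^esub> (F (Suc n) +> q n) = F (Suc n) +> (p n \<oplus> q n)"
    using ideal.a_rcos_sum[OF ideal_F up_carrier[OF rees_up[OF assms(1)]] up_carrier[OF rees_up[OF assms(2)]]] .
  then show "(cls p \<oplus>\<^bsub>gr\<^esub> cls q) n = cls (p \<oplus>\<^bsub>UP R\<^esub> q) n"
    using UP_add[OF rees_up[OF assms(1)] rees_up[OF assms(2)]] by (simp add: graded_quotient_def cls_def)
qed

lemma cls_mult:
  assumes "p \<in> rees" "q \<in> rees"
  shows "cls p \<otimes>\<^bsub>gr\<^esub> cls q = cls (p \<otimes>\<^bsub>UP R\<^esub> q)"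
proof
  fix n
  interpret I: ideal "F (Suc n)" R by (rule ideal_F)
  let ?S = "R Quot F (Suc n)"
  interpret h: ring_hom_cring R ?S "(+>) (F (Suc n))" by (rule I.rcos_ring_hom_cring[OF is_cring])
  note F = rees_F[OF assms(1)] rees_F[OF assms(2)]
  have car: "p i \<otimes> q (n - i) \<in> carrier R" for i using F[THEN F_carrier] by simp
  have "(cls p \<otimes>\<^bsub>gr\<^esub> cls q) n
      = finsum ?S (\<lambda>i. rcoset_mult R (F (Suc n)) (F (Suc i) +> p i) (F (Suc (n - i)) +> q (n - i))) {..n}"
    by (simp add: graded_quotient_def cls_def)
  also have "\<dots> = finsum ?S ((+>) (F (Suc n)) \<circ> (\<lambda>i. p i \<otimes> q (n - i))) {..n}"
  proof (rule h.S.finsum_cong')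
    show "((+>) (F (Suc n)) \<circ> (\<lambda>i. p i \<otimes> q (n - i))) \<in> {..n} \<rightarrow> carrier ?S" using car by simp
    fix i assume "i \<in> {..n}"
    then show "rcoset_mult R (F (Suc n)) (F (Suc i) +> p i) (F (Suc (n - i)) +> q (n - i))
        = ((+>) (F (Suc n)) \<circ> (\<lambda>i. p i \<otimes> q (n - i))) i"
      using coset_mult[OF F(1)[of i] F(2)[of "n - i"]] by simp
  qed simp
  also have "\<dots> = F (Suc n) +> (\<Oplus>i\<in>{..n}. p i \<otimes> q (n - i))"
    by (rule h.hom_finsum[symmetric]) (use car in simp)
  also have "\<dots> = cls (p \<otimes>\<^bsub>UP R\<^esub> q) n"
    using UP_mult[OF rees_up[OF assms(1)] rees_up[OF assms(2)]] by (simp add: cls_def)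
  finally show "(cls p \<otimes>\<^bsub>gr\<^esub> cls q) n = cls (p \<otimes>\<^bsub>UP R\<^esub> q) n" .
qed

lemma cls_one: "cls \<one>\<^bsub>UP R\<^esub> = \<one>\<^bsub>gr\<^esub>"
  unfolding UP_one using coset_zero_iff[OF zero_closed]
  by (auto simp: cls_def single_def graded_quotient_def fun_eq_iff)

text \<open>The map \<open>cls\<close> is surjective and respects the operations, so the ring laws
  of \<open>gr\<close> are inherited from the Rees ring.\<close>

lemma cring_gr: "cring gr"
proof -
  let ?U = "UP R\<lparr>carrier := rees\<rparr>"
  interpret A: ring ?U by (rule U.P.subring_is_ring[OF subring_rees])
  have "cls \<in> ring_hom ?U gr"
    by (rule ring_hom_memI) (simp_all add: cls_closed cls_add cls_mult cls_one)
  from A.ring_hom_imp_img_ring[OF this]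
  have "ring (gr\<lparr>carrier := cls ` rees, ring.zero := \<zero>\<^bsub>gr\<^esub>\<rparr>)"
    by (simp add: UP_zero cls_zero)
  moreover have "cls ` rees = carrier gr" by (auto elim: gr_cases simp: cls_closed)
  ultimately have "ring gr" by simp
  then show ?thesis
  proof (rule cring.intro)
    show "comm_monoid gr"
    proof (rule monoid.monoid_comm_monoidI)
      show "monoid gr" using \<open>ring gr\<close> by (rule ring.axioms(2))
      fix f g assume "f \<in> carrier gr" "g \<in> carrier gr"
      then obtain p q where "p \<in> rees" "q \<in> rees" "f = cls p" "g = cls q" by (metis gr_cases)
      then show "f \<otimes>\<^bsub>gr\<^esub> g = g \<otimes>\<^bsub>gr\<^esub> f"
        using U.UP_m_comm[of p q] rees_up by (simp add: cls_mult UP_carrier)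
    qed
  qed
qed

lemma form_closed: "x \<in> F n \<Longrightarrow> form n x \<in> carrier gr"
  unfolding form_def by (intro cls_closed single_rees)

lemma form_add: "x \<in> F n \<Longrightarrow> y \<in> F n \<Longrightarrow> form n x \<oplus>\<^bsub>gr\<^esub> form n y = form n (x \<oplus> y)"
  using U.monom_add[of x y n] F_carrier by (simp add: form_def cls_add single_rees UP_monom)

lemma form_mult: "x \<in> F n \<Longrightarrow> y \<in> F k \<Longrightarrow> form n x \<otimes>\<^bsub>gr\<^esub> form k y = form (n + k) (x \<otimes> y)"
  using U.monom_mult[of x y n k] F_carrier[of x n] F_carrier[of y k]
  by (simp add: form_def cls_mult single_rees UP_monom)

lemma form_one: "form 0 \<one> = \<one>\<^bsub>gr\<^esub>"
  using cls_one by (simp add: form_def UP_one)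

lemma form_zero_iff: "x \<in> F n \<Longrightarrow> form n x = \<zero>\<^bsub>gr\<^esub> \<longleftrightarrow> x \<in> F (Suc n)"
  unfolding form_def using cls_zero_iff[OF single_rees] by (auto simp: single_def)

lemma form_pow: "x \<in> F n \<Longrightarrow> form n x [^]\<^bsub>gr\<^esub> (k::nat) = form (n * k) (x [^] k)"
proof (induction k)
  case 0
  interpret G: cring gr by (rule cring_gr)
  show ?case by (simp add: form_one)
next
  case (Suc k)
  interpret G: cring gr by (rule cring_gr)
  show ?case using Suc form_mult[OF F_pow[OF Suc.prems, of k] Suc.prems] by (simp add: add.commute)
qed

lemma mult_single:
  assumes p: "p \<in> up R" and y: "y \<in> carrier R"
  shows "(p \<otimes>\<^bsub>UP R\<^esub> single k y) n = (if k \<le> n then p (n - k) \<otimes> y else \<zero>)"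
proof -
  \<comment> \<open>The condition \<open>k \<le> n\<close> guards against truncated subtraction,
    which gives index 0 when \<open>n < k\<close>.\<close>
  have "(p \<otimes>\<^bsub>UP R\<^esub> single k y) n = (\<Oplus>i\<in>{..n}. if n - k = i \<and> k \<le> n then p i \<otimes> y else \<zero>)"
    unfolding UP_mult[OF p single_up[OF y]]
    by (rule add.finprod_cong') (use y up_carrier[OF p] in \<open>auto simp: single_def\<close>)
  then show ?thesis
    using add.finprod_singleton[of "n - k" "{..n}" "\<lambda>i. p i \<otimes> y"] y up_carrier[OF p] by auto
qed

lemma cls_mult_form_zero_iff:
  assumes p: "p \<in> rees" and y: "y \<in> F k"
  shows "cls p \<otimes>\<^bsub>gr\<^esub> form k y = \<zero>\<^bsub>gr\<^esub> \<longleftrightarrow> (\<forall>n. p n \<otimes> y \<in> F (Suc (n + k)))"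
proof -
  note s = single_rees[OF y]
  have pm: "p \<otimes>\<^bsub>UP R\<^esub> single k y \<in> rees" using subringE(6)[OF subring_rees p s] .
  have "cls p \<otimes>\<^bsub>gr\<^esub> form k y = \<zero>\<^bsub>gr\<^esub> \<longleftrightarrow> (\<forall>n. (p \<otimes>\<^bsub>UP R\<^esub> single k y) n \<in> F (Suc n))"
    unfolding form_def cls_mult[OF p s] using cls_zero_iff[OF pm] .
  also have "\<dots> \<longleftrightarrow> (\<forall>n. p n \<otimes> y \<in> F (Suc (n + k)))"
    unfolding mult_single[OF rees_up[OF p] F_carrier[OF y]]
    by (metis F_zero add_diff_cancel_right' le_add2 le_add_diff_inverse2)
  finally show ?thesis .
qed

text \<open>A class is the finite sum of its forms, reached here through the truncations
  \<open>t N\<close>. Only zero and closure under addition are asked of \<open>Q\<close>, so the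
  lemma serves for prime ideals and for subrings.\<close>

lemma cls_in_if_forms_in:
  assumes p: "p \<in> rees" and zero: "\<zero>\<^bsub>gr\<^esub> \<in> Q"
    and add: "\<And>f g. f \<in> Q \<Longrightarrow> g \<in> Q \<Longrightarrow> f \<oplus>\<^bsub>gr\<^esub> g \<in> Q"
    and forms: "\<And>n. form n (p n) \<in> Q"
  shows "cls p \<in> Q"
proof -
  define t where "t N = (\<lambda>i. if i < N then p i else \<zero>)" for N :: nat
  have t: "t N \<in> rees" for N
    unfolding rees_def t_def using rees_F[OF p] up_carrier[OF rees_up[OF p]]
    by (auto intro!: mem_upI exI[of _ N] bound.intro)
  have "cls (t N) \<in> Q" for N
  proof (induction N)
    case 0
    have "t 0 = (\<lambda>n. \<zero>)" unfolding t_def by simp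
    then show ?case using zero cls_zero by simp
  next
    case (Suc N)
    have "t (Suc N) = t N \<oplus>\<^bsub>UP R\<^esub> single N (p N)"
      unfolding UP_add[OF rees_up[OF t] rees_up[OF single_rees[OF rees_F[OF p]]]]
      using up_carrier[OF rees_up[OF p]] by (auto simp: t_def single_def fun_eq_iff less_Suc_eq)
    then have "cls (t (Suc N)) = cls (t N) \<oplus>\<^bsub>gr\<^esub> form N (p N)"
      unfolding form_def using cls_add[OF t single_rees[OF rees_F[OF p]]] by simp
    then show ?case using add[OF Suc forms] by simp
  qed
  moreover obtain N where N: "bound \<zero> N p" using rees_up[OF p] by auto
  have "p = t (Suc N)"
    using bound.bound[OF N] by (auto simp: t_def fun_eq_iff)
  ultimately show ?thesis by metis
qed

end

section \<open>Homogeneous primes and zero divisors\<close>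

text \<open>Intended for a coefficient of a product of polynomials: when all terms but the one from
  two extremal degrees are under control, that term is too.\<close>

lemma (in abelian_group) term_in_subgroup:
  assumes S: "additive_subgroup S G" and "finite A" "j \<in> A"
    and f: "\<And>i. i \<in> A \<Longrightarrow> f i \<in> carrier G"
    and sum: "(\<Oplus>i\<in>A. f i) \<in> S"
    and rest: "\<And>i. i \<in> A \<Longrightarrow> i \<noteq> j \<Longrightarrow> f i \<in> S"
  shows "f j \<in> S"
proof -
  interpret S: additive_subgroup S G by (rule S)
  have zero: "\<zero> \<in> S" and add: "\<And>a b. a \<in> S \<Longrightarrow> b \<in> S \<Longrightarrow> a \<oplus> b \<in> S"
    and minus: "\<And>a. a \<in> S \<Longrightarrow> \<ominus> a \<in> S"
    using S.zero_closed S.a_closed additive_subgroup.a_inv_closed[OF S] by auto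
  have "(\<Oplus>i\<in>B. f i) \<in> S" if "finite B" "B \<subseteq> A - {j}" for B
    using that
  proof (induction B)
    case (insert b B)
    have "f \<in> B \<rightarrow> carrier G" "f b \<in> carrier G" using insert.prems f by auto
    then have "(\<Oplus>i\<in>insert b B. f i) = f b \<oplus> (\<Oplus>i\<in>B. f i)" using insert.hyps by simp
    then show ?case using insert rest add by auto
  qed (simp add: zero)
  then have r: "(\<Oplus>i\<in>A - {j}. f i) \<in> S" using \<open>finite A\<close> by blast
  have rc: "(\<Oplus>i\<in>A - {j}. f i) \<in> carrier G" using f by (intro finsum_closed) auto
  have "(\<Oplus>i\<in>insert j (A - {j}). f i) = f j \<oplus> (\<Oplus>i\<in>A - {j}. f i)"
    using \<open>finite A\<close> f \<open>j \<in> A\<close> by (intro finsum_insert) auto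
  moreover have "insert j (A - {j}) = A" using \<open>j \<in> A\<close> by auto
  ultimately have "f j = (\<Oplus>i\<in>A. f i) \<oplus> (\<ominus> (\<Oplus>i\<in>A - {j}. f i))"
    using rc f[OF \<open>j \<in> A\<close>] by (simp add: a_assoc r_neg)
  then show ?thesis using add[OF sum minus[OF r]] by simp
qed

context filtration
begin

lemma rees_finite:
  assumes p: "p \<in> rees" and S: "\<And>n. \<zero> \<in> S n"
  shows "finite {n. p n \<notin> S n}"
proof -
  obtain N where N: "bound \<zero> N p" using rees_up[OF p] by auto
  have "{n. p n \<notin> S n} \<subseteq> {..N}"
  proof
    fix n assume n: "n \<in> {n. p n \<notin> S n}"
    then have "p n \<noteq> \<zero>" using S[of n] by (metis mem_Collect_eq)
    then show "n \<in> {..N}" using bound_below[OF N] by simp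
  qed
  then show ?thesis using finite_subset by blast
qed

lemma rees_mult_closed: "p \<in> rees \<Longrightarrow> q \<in> rees \<Longrightarrow> p \<otimes>\<^bsub>UP R\<^esub> q \<in> rees"
  and rees_add_closed: "p \<in> rees \<Longrightarrow> q \<in> rees \<Longrightarrow> p \<oplus>\<^bsub>UP R\<^esub> q \<in> rees"
  using subringE(6,7)[OF subring_rees] by auto

text \<open>Homogeneous ideals of \<open>gr\<close> are described on representatives: \<open>T n\<close> lies between \<open>F (n + 1)\<close>
  and \<open>F n\<close>, and the ideal is \<open>\<Oplus>n. T n / F (n + 1)\<close>.\<close>

definition homogeneous_prime :: "(nat \<Rightarrow> 'a set) \<Rightarrow> bool" where
  "homogeneous_prime T \<longleftrightarrow>
    (\<forall>n. T n \<subseteq> F n \<and> F (Suc n) \<subseteq> T n) \<and>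
    (\<forall>n. \<forall>a\<in>T n. \<forall>b\<in>T n. a \<oplus> b \<in> T n) \<and>
    (\<forall>i j. \<forall>a\<in>F i. \<forall>b\<in>T j. a \<otimes> b \<in> T (i + j)) \<and>
    (\<forall>i j. \<forall>a\<in>F i. \<forall>b\<in>F j. a \<otimes> b \<in> T (i + j) \<longrightarrow> a \<in> T i \<or> b \<in> T j) \<and>
    \<one> \<notin> T 0"

definition cls_set :: "(nat \<Rightarrow> 'a set) \<Rightarrow> (nat \<Rightarrow> 'a set) set" where
  "cls_set T = {cls p |p. p \<in> rees \<and> (\<forall>n. p n \<in> T n)}"

context
  fixes T
  assumes T: "homogeneous_prime T"
begin

lemma
  shows T_F: "a \<in> T n \<Longrightarrow> a \<in> F n"
    and F_Suc_T: "a \<in> F (Suc n) \<Longrightarrow> a \<in> T n"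
    and T_add: "a \<in> T n \<Longrightarrow> b \<in> T n \<Longrightarrow> a \<oplus> b \<in> T n"
    and T_mult: "a \<in> F i \<Longrightarrow> b \<in> T j \<Longrightarrow> a \<otimes> b \<in> T (i + j)"
    and T_prime: "a \<in> F i \<Longrightarrow> b \<in> F j \<Longrightarrow> a \<otimes> b \<in> T (i + j) \<Longrightarrow> a \<in> T i \<or> b \<in> T j"
    and T_one: "\<one> \<notin> T 0"
  using T unfolding homogeneous_prime_def by auto

lemma T_zero: "\<zero> \<in> T n"
  by (rule F_Suc_T[OF F_zero])

lemma T_minus:
  assumes a: "a \<in> T n"
  shows "\<ominus> a \<in> T n"
proof -
  have "(\<ominus> \<one>) \<otimes> a \<in> T (0 + n)" by (rule T_mult) (simp_all add: F_0 a)
  then show ?thesis using F_carrier[OF T_F[OF a]] by (simp add: l_minus)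
qed

lemma T_subgroup: "additive_subgroup (T n) R"
proof (rule additive_subgroup.intro, rule add.subgroupI)
  show "T n \<subseteq> carrier R" using T_F F_carrier by auto
  show "T n \<noteq> {}" using T_zero[of n] by auto
qed (use T_add T_minus in auto)

lemma cls_mem_cls_set_iff:
  assumes p: "p \<in> rees"
  shows "cls p \<in> cls_set T \<longleftrightarrow> (\<forall>n. p n \<in> T n)"
proof
  assume "cls p \<in> cls_set T"
  then obtain q where q: "q \<in> rees" "\<forall>n. q n \<in> T n" "cls p = cls q"
    unfolding cls_set_def by auto
  show "\<forall>n. p n \<in> T n"
  proof
    fix n
    have c: "p n \<in> carrier R" "q n \<in> carrier R" using up_carrier rees_up p q by auto
    have "p n \<ominus> q n \<in> T n" using F_Suc_T cls_eq_iff[OF p q(1)] q(3) by simp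
    then have "(p n \<ominus> q n) \<oplus> q n \<in> T n" using T_add q(2) by simp
    moreover have "(p n \<ominus> q n) \<oplus> q n = p n" using c by algebra
    ultimately show "p n \<in> T n" by simp
  qed
qed (use p in \<open>auto simp: cls_set_def\<close>)

lemma form_mem_cls_set_iff: "x \<in> F n \<Longrightarrow> form n x \<in> cls_set T \<longleftrightarrow> x \<in> T n"
  unfolding form_def using cls_mem_cls_set_iff[OF single_rees] T_zero by (auto simp: single_def)

text \<open>For a homogeneous ideal, primality on forms suffices. If \<open>p\<close> and
  \<open>q\<close> both have components outside \<open>T\<close>, let \<open>s\<close> and
  \<open>r\<close> be the largest such degrees; in degree \<open>s + r\<close> of the product every
  other term lies in \<open>T\<close>, so \<open>p s \<otimes> q r\<close> would as well, against
  primality on forms.\<close>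

lemma primeideal_cls_set: "primeideal (cls_set T) gr"
proof -
  interpret G: cring gr by (rule cring_gr)
  have cases: "\<exists>p. p \<in> rees \<and> (\<forall>n. p n \<in> T n) \<and> f = cls p" if "f \<in> cls_set T" for f
    using that unfolding cls_set_def by auto
  have mult: "g \<otimes>\<^bsub>gr\<^esub> f \<in> cls_set T" if f: "f \<in> cls_set T" and g: "g \<in> carrier gr" for f g
  proof -
    obtain p where p: "p \<in> rees" "\<forall>n. p n \<in> T n" "f = cls p" using cases[OF f] by auto
    obtain q where q: "q \<in> rees" "g = cls q" using g by (rule gr_cases)
    have "(q \<otimes>\<^bsub>UP R\<^esub> p) n \<in> T n" for n
    proof -
      have summand: "q i \<otimes> p (n - i) \<in> T n" if "i \<le> n" for i
        using T_mult[OF rees_F[OF q(1)], of "p (n - i)" "n - i" i] p(2) that by simp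
      have "(\<Oplus>i\<in>B. q i \<otimes> p (n - i)) \<in> T n" if "finite B" "B \<subseteq> {..n}" for B
        using that
      proof (induction B)
        case (insert b B)
        have "(\<lambda>i. q i \<otimes> p (n - i)) \<in> insert b B \<rightarrow> carrier R"
          using up_carrier[OF rees_up] p(1) q(1) by simp
        then have "(\<Oplus>i\<in>insert b B. q i \<otimes> p (n - i)) = q b \<otimes> p (n - b) \<oplus> (\<Oplus>i\<in>B. q i \<otimes> p (n - i))"
          using insert.hyps by (intro finsum_insert) auto
        then show ?case using insert T_add summand by auto
      qed (simp add: T_zero)
      then show ?thesis unfolding UP_mult[OF rees_up[OF q(1)] rees_up[OF p(1)]] by simp
    qed
    then show ?thesis
      unfolding p(3) q(2) cls_mult[OF q(1) p(1)] cls_mem_cls_set_iff[OF rees_mult_closed[OF q(1) p(1)]]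
      by simp
  qed
  have sub: "cls_set T \<subseteq> carrier gr" unfolding cls_set_def using cls_closed by auto
  have "additive_subgroup (cls_set T) gr"
  proof (rule additive_subgroup.intro, rule G.add.subgroupI)
    show "cls_set T \<subseteq> carrier gr" by (rule sub)
    have "form 0 \<zero> \<in> cls_set T" using form_mem_cls_set_iff[OF F_zero] T_zero by simp
    then show "cls_set T \<noteq> {}" by auto
  next
    fix f assume f: "f \<in> cls_set T"
    have "(\<ominus>\<^bsub>gr\<^esub> \<one>\<^bsub>gr\<^esub>) \<otimes>\<^bsub>gr\<^esub> f \<in> cls_set T" by (rule mult[OF f]) simp
    then show "\<ominus>\<^bsub>gr\<^esub> f \<in> cls_set T" using f sub by (auto simp: G.l_minus)
  next
    fix f g assume "f \<in> cls_set T" "g \<in> cls_set T"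
    then obtain p q where pq: "p \<in> rees" "\<forall>n. p n \<in> T n" "f = cls p"
      "q \<in> rees" "\<forall>n. q n \<in> T n" "g = cls q" using cases by metis
    show "f \<oplus>\<^bsub>gr\<^esub> g \<in> cls_set T"
      using cls_mem_cls_set_iff[OF rees_add_closed[OF pq(1,4)]] T_add pq(2,5)
      unfolding pq(3,6) cls_add[OF pq(1,4)] UP_add[OF rees_up[OF pq(1)] rees_up[OF pq(4)]] by simp
  qed
  then show ?thesis
  proof (rule primeidealI2[OF _ cring_gr])
    fix f g assume f: "f \<in> cls_set T" and g: "g \<in> carrier gr"
    show gf: "g \<otimes>\<^bsub>gr\<^esub> f \<in> cls_set T" by (rule mult[OF f g])
    have "f \<in> carrier gr" using f sub by auto
    then show "f \<otimes>\<^bsub>gr\<^esub> g \<in> cls_set T" using gf g G.m_comm by simp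
  next
    have "form 0 \<one> \<notin> cls_set T" using form_mem_cls_set_iff[of \<one> 0] T_one F_0 by simp
    then show "carrier gr \<noteq> cls_set T" using form_one G.one_closed by auto
  next
    fix f g assume "f \<in> carrier gr" "g \<in> carrier gr" and fg: "f \<otimes>\<^bsub>gr\<^esub> g \<in> cls_set T"
    then obtain p q where pq: "p \<in> rees" "f = cls p" "q \<in> rees" "g = cls q" by (metis gr_cases)
    have prod: "(\<Oplus>i\<in>{..n}. p i \<otimes> q (n - i)) \<in> T n" for n
      using fg cls_mem_cls_set_iff[OF rees_mult_closed[OF pq(1,3)]]
      unfolding pq(2,4) cls_mult[OF pq(1,3)] UP_mult[OF rees_up[OF pq(1)] rees_up[OF pq(3)]] by simp
    show "f \<in> cls_set T \<or> g \<in> cls_set T"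
    proof (rule ccontr)
      assume neg: "\<not> (f \<in> cls_set T \<or> g \<in> cls_set T)"
      define s where "s = Max {n. p n \<notin> T n}"
      define r where "r = Max {n. q n \<notin> T n}"
      have ne: "{n. p n \<notin> T n} \<noteq> {}" "{n. q n \<notin> T n} \<noteq> {}"
        using neg unfolding pq(2,4) cls_mem_cls_set_iff[OF pq(1)] cls_mem_cls_set_iff[OF pq(3)] by auto
      note fin = rees_finite[OF pq(1), of T, OF T_zero] rees_finite[OF pq(3), of T, OF T_zero]
      have s: "p s \<notin> T s" "\<And>i. s < i \<Longrightarrow> p i \<in> T i"
        using Max_in[OF fin(1) ne(1)] Max_ge[OF fin(1)] unfolding s_def by (auto simp: not_le[symmetric])
      have r: "q r \<notin> T r" "\<And>i. r < i \<Longrightarrow> q i \<in> T i"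
        using Max_in[OF fin(2) ne(2)] Max_ge[OF fin(2)] unfolding r_def by (auto simp: not_le[symmetric])
      \<comment> \<open>If \<open>i\<close> exceeds \<open>s\<close>, the first factor is in
        \<open>T\<close>; if it is smaller, the index of the second factor exceeds
        \<open>r\<close>.\<close>
      have rest: "p i \<otimes> q (s + r - i) \<in> T (s + r)" if i: "i \<in> {..s + r}" "i \<noteq> s" for i
      proof (cases "s < i")
        case True
        have "q (s + r - i) \<otimes> p i \<in> T (s + r - i + i)"
          using T_mult[OF rees_F[OF pq(3)] s(2)[OF True]] .
        moreover have "q (s + r - i) \<otimes> p i = p i \<otimes> q (s + r - i)"
          by (rule m_comm) (use up_carrier[OF rees_up] pq in auto)
        ultimately show ?thesis using i by simp
      next
        case False
        then have "r < s + r - i" using i by simp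
        then show ?thesis using T_mult[OF rees_F[OF pq(1)] r(2), of "s + r - i" i] i by simp
      qed
      have "p s \<otimes> q (s + r - s) \<in> T (s + r)"
        using term_in_subgroup[OF T_subgroup, of "{..s + r}" s "\<lambda>i. p i \<otimes> q (s + r - i)", OF _ _ _ prod rest]
          up_carrier[OF rees_up[OF pq(1)]] up_carrier[OF rees_up[OF pq(3)]] by simp
      then show False using T_prime[OF rees_F[OF pq(1)] rees_F[OF pq(3)], of s r] s(1) r(1) by simp
    qed
  qed
qed

end

text \<open>McCoy's argument: take an annihilator \<open>q\<close> of \<open>p\<close> with the fewest nonzero components and let \<open>r\<close> be
  its degree.  If \<open>p\<close> is not killed by the top form of \<open>q\<close>, let \<open>s\<close> be the largest degree such that
  the component of \<open>p\<close> in degree \<open>s\<close> does not kill \<open>q\<close>; its product with \<open>q\<close> is an annihilator of \<open>p\<close>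
  that has lost the component coming from degree \<open>r\<close>.\<close>

lemma zero_divisor_kills_form:
  assumes p: "p \<in> rees" and "q \<in> rees" "cls q \<noteq> \<zero>\<^bsub>gr\<^esub>" "cls p \<otimes>\<^bsub>gr\<^esub> cls q = \<zero>\<^bsub>gr\<^esub>"
  shows "\<exists>k y. y \<in> F k \<and> y \<notin> F (Suc k) \<and> cls p \<otimes>\<^bsub>gr\<^esub> form k y = \<zero>\<^bsub>gr\<^esub>"
  using assms(2-4)
proof (induction "card {j. q j \<notin> F (Suc j)}" arbitrary: q rule: less_induct)
  case less
  note q = less.prems(1)
  interpret G: cring gr by (rule cring_gr)
  let ?N = "\<lambda>q. {j. q j \<notin> F (Suc j)}"
  have pc: "p i \<in> carrier R" and qc: "q i \<in> carrier R" for i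
    using up_carrier[OF rees_up[OF p]] up_carrier[OF rees_up[OF q]] by auto
  have fin: "finite (?N q)" using rees_finite[OF q, of "\<lambda>j. F (Suc j)"] F_zero by simp
  have ne: "?N q \<noteq> {}" using less.prems(2) cls_zero_iff[OF q] by simp
  define r where "r = Max (?N q)"
  have r: "q r \<notin> F (Suc r)" "\<And>j. r < j \<Longrightarrow> q j \<in> F (Suc j)"
    using Max_in[OF fin ne] Max_ge[OF fin] unfolding r_def by (auto simp: not_le[symmetric])
  have prod: "(\<Oplus>i\<in>{..n}. p i \<otimes> q (n - i)) \<in> F (Suc n)" for n
    using less.prems(3) cls_zero_iff[OF rees_mult_closed[OF p q]]
    unfolding cls_mult[OF p q] UP_mult[OF rees_up[OF p] rees_up[OF q]] by simp
  show ?case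
  proof (cases "\<forall>i. p i \<otimes> q r \<in> F (Suc (i + r))")
    case True
    then have "cls p \<otimes>\<^bsub>gr\<^esub> form r (q r) = \<zero>\<^bsub>gr\<^esub>"
      using cls_mult_form_zero_iff[OF p rees_F[OF q]] by simp
    then show ?thesis using r(1) rees_F[OF q] by blast
  next
    case False
    let ?S = "{i. \<exists>j. p i \<otimes> q j \<notin> F (Suc (i + j))}"
    have "?S \<subseteq> {i. p i \<notin> {\<zero>}}"
    proof
      fix i assume "i \<in> ?S"
      then obtain j where "p i \<otimes> q j \<notin> F (Suc (i + j))" by auto
      then have "p i \<noteq> \<zero>" using qc[of j] F_zero by auto
      then show "i \<in> {i. p i \<notin> {\<zero>}}" by simp
    qed
    then have finS: "finite ?S" using rees_finite[OF p, of "\<lambda>_. {\<zero>}"] finite_subset by simp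
    have neS: "?S \<noteq> {}" using False by auto
    define s where "s = Max ?S"
    obtain j0 where j0: "p s \<otimes> q j0 \<notin> F (Suc (s + j0))"
      using Max_in[OF finS neS] unfolding s_def by auto
    have s: "p i \<otimes> q j \<in> F (Suc (i + j))" if "s < i" for i j
      using Max_ge[OF finS, of i] that unfolding s_def by (auto simp: not_le[symmetric])
    \<comment> \<open>In degree \<open>s + r\<close> of the vanishing product, terms with
      \<open>i > s\<close> vanish by the choice of \<open>s\<close>, and those with
      \<open>i < s\<close> because the index at \<open>q\<close> exceeds \<open>r\<close>. So
      \<open>p s\<close> kills the top form of \<open>q\<close>, which is how a component is lost;
      \<open>j0\<close> witnesses that the new annihilator is still nonzero.\<close>
    have rest: "p i \<otimes> q (s + r - i) \<in> F (Suc (s + r))" if i: "i \<in> {..s + r}" "i \<noteq> s" for i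
    proof (cases "s < i")
      case True
      then show ?thesis using s[OF True, of "s + r - i"] i by simp
    next
      case False
      then have "r < s + r - i" using i by simp
      then show ?thesis using F_mult[OF rees_F[OF p] r(2), of "s + r - i" i] i by simp
    qed
    have "p s \<otimes> q (s + r - s) \<in> F (Suc (s + r))"
      using term_in_subgroup[OF ideal.axioms(1)[OF ideal_F], of "{..s + r}" s
          "\<lambda>i. p i \<otimes> q (s + r - i)", OF _ _ _ prod rest] pc qc by simp
    then have sr: "q r \<otimes> p s \<in> F (Suc (r + s))"
      using m_comm[OF pc qc] by (simp add: add.commute)
    let ?q = "q \<otimes>\<^bsub>UP R\<^esub> single s (p s)"
    note ps = single_rees[OF rees_F[OF p, of s]]
    have q': "?q \<in> rees" by (rule rees_mult_closed[OF q ps])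
    have coeff: "?q n = (if s \<le> n then q (n - s) \<otimes> p s else \<zero>)" for n
      by (rule mult_single[OF rees_up[OF q] pc])
    have "?N ?q \<subseteq> (\<lambda>j. j + s) ` (?N q - {r})"
    proof
      fix n assume n: "n \<in> ?N ?q"
      then have sn: "s \<le> n" and nz: "q (n - s) \<otimes> p s \<notin> F (Suc n)"
        using coeff[of n] F_zero[of "Suc n"] by (auto split: if_splits)
      have "n - s \<noteq> r" using nz sr sn by auto
      moreover have "q (n - s) \<notin> F (Suc (n - s))"
        using nz F_mult[of "q (n - s)" "Suc (n - s)" "p s" s] rees_F[OF p] sn by auto
      ultimately show "n \<in> (\<lambda>j. j + s) ` (?N q - {r})" using sn by (intro image_eqI[of _ _ "n - s"]) auto
    qed
    then have "card (?N ?q) \<le> card ((\<lambda>j. j + s) ` (?N q - {r}))" using fin by (intro card_mono) auto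
    also have "\<dots> \<le> card (?N q - {r})" using fin by (intro card_image_le) simp
    also have "\<dots> < card (?N q)" using fin r(1) by (intro card_Diff1_less) auto
    finally have small: "card (?N ?q) < card (?N q)" .
    have "cls ?q \<noteq> \<zero>\<^bsub>gr\<^esub>"
    proof
      assume "cls ?q = \<zero>\<^bsub>gr\<^esub>"
      then have "?q (j0 + s) \<in> F (Suc (j0 + s))" using cls_zero_iff[OF q'] by simp
      then show False using j0 coeff[of "j0 + s"] m_comm[OF pc qc, of s j0] by (simp add: add.commute)
    qed
    moreover have "cls p \<otimes>\<^bsub>gr\<^esub> cls ?q = \<zero>\<^bsub>gr\<^esub>"
    proof -
      have "cls p \<otimes>\<^bsub>gr\<^esub> cls ?q = (cls p \<otimes>\<^bsub>gr\<^esub> cls q) \<otimes>\<^bsub>gr\<^esub> cls (single s (p s))"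
        using G.m_assoc cls_closed[OF p] cls_closed[OF q] cls_closed[OF ps] cls_mult[OF q ps] by simp
      then show ?thesis using less.prems(3) cls_closed[OF ps] by simp
    qed
    ultimately show ?thesis using less.hyps[OF small q'] by simp
  qed
qed

end

section \<open>Veronese filtrations and ideal powers\<close>

lemma (in primeideal) nat_pow_mem_imp_mem:
  assumes x: "x \<in> carrier R" and pow: "x [^] (n::nat) \<in> I"
  shows "x \<in> I"
  using pow
proof (induction n)
  case 0
  then show ?case using one_imp_carrier I_notcarr by simp
next
  case (Suc n)
  then show ?case using I_prime[of "x [^] n" x] x by auto
qed

context filtration
begin

lemma filtration_veronese: "filtration R (\<lambda>n. F (m * n))"
proof (rule filtration.intro[OF is_cring], rule filtration_axioms.intro)
  show "F (m * 0) = carrier R" by (simp add: F_0)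
  show "F (m * Suc n) \<subseteq> F (m * n)" for n by (rule F_antimono) simp
  show "a \<otimes> b \<in> F (m * (i + j))" if "a \<in> F (m * i)" "b \<in> F (m * j)" for a b i j
    using F_mult[OF that] by (simp add: distrib_left)
qed (rule ideal_F)

context
  fixes m :: nat
  assumes m: "1 \<le> m"
begin

interpretation V: filtration R "\<lambda>n. F (m * n)"
  by (rule filtration_veronese)

text \<open>Membership in \<open>Q\<close> is tested on forms only, so \<open>Q\<close> may be any
  prime; if it is inhomogeneous, the family describes the largest homogeneous ideal inside its
  preimage.\<close>

lemma veronese_homogeneous_prime:
  assumes Q: "primeideal Q gr"
  shows "V.homogeneous_prime (\<lambda>n. {x \<in> F (m * n). form (m * n) x \<in> Q})" (is "V.homogeneous_prime ?T")
proof -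
  interpret Q: primeideal Q gr by (rule Q)
  have zero: "\<zero>\<^bsub>gr\<^esub> \<in> Q" and add: "\<And>f g. f \<in> Q \<Longrightarrow> g \<in> Q \<Longrightarrow> f \<oplus>\<^bsub>gr\<^esub> g \<in> Q"
    using additive_subgroup.zero_closed[OF Q.additive_subgroup_axioms]
      additive_subgroup.a_closed[OF Q.additive_subgroup_axioms] by auto
  show ?thesis
    unfolding V.homogeneous_prime_def
  proof (intro conjI allI ballI impI)
    fix n
    show "?T n \<subseteq> F (m * n)" by auto
    show "F (m * Suc n) \<subseteq> ?T n"
    proof
      \<comment> \<open>Positivity of \<open>m\<close> enters here: order \<open>m * n + m\<close>
        exceeds \<open>m * n\<close>, so the form in degree \<open>m * n\<close> is zero.\<close>
      fix x assume x: "x \<in> F (m * Suc n)"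
      have "x \<in> F (m * n)" "x \<in> F (Suc (m * n))"
        using x F_antimono[of "m * n" "m * Suc n"] F_antimono[of "Suc (m * n)" "m * Suc n"] m by auto
      moreover from this have "form (m * n) x = \<zero>\<^bsub>gr\<^esub>" using form_zero_iff by simp
      ultimately show "x \<in> ?T n" using zero by simp
    qed
  next
    fix n a b assume "a \<in> ?T n" "b \<in> ?T n"
    then show "a \<oplus> b \<in> ?T n" using F_add form_add add by (metis (no_types, lifting) mem_Collect_eq)
  next
    fix i j a b assume a: "a \<in> F (m * i)" and b: "b \<in> ?T j"
    have "form (m * i) a \<otimes>\<^bsub>gr\<^esub> form (m * j) b \<in> Q" using Q.I_l_closed b form_closed[OF a] by simp
    then show "a \<otimes> b \<in> ?T (i + j)"
      using form_mult[OF a, of b "m * j"] F_mult[OF a, of b "m * j"] b by (simp add: distrib_left)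
  next
    fix i j a b assume a: "a \<in> F (m * i)" and b: "b \<in> F (m * j)" and ab: "a \<otimes> b \<in> ?T (i + j)"
    have "form (m * i) a \<otimes>\<^bsub>gr\<^esub> form (m * j) b \<in> Q"
      using ab form_mult[OF a b] by (simp add: distrib_left)
    then show "a \<in> ?T i \<or> b \<in> ?T j"
      using Q.I_prime[OF form_closed[OF a] form_closed[OF b]] a b by auto
  next
    show "\<one> \<notin> ?T 0" using form_one Q.one_imp_carrier Q.I_notcarr by auto
  qed
qed

lemma veronese_contraction_minimal:
  assumes N: "noetherian_ring gr" and Q: "minimal_prime gr Q"
  shows "minimal_prime V.gr (V.cls_set (\<lambda>n. {x \<in> F (m * n). form (m * n) x \<in> Q}))"
    (is "minimal_prime V.gr (V.cls_set ?T)")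
proof -
  interpret G: cring gr by (rule cring_gr)
  interpret H: cring V.gr by (rule V.cring_gr)
  interpret Q: primeideal Q gr using Q by (simp add: minimal_prime_def)
  have zero: "\<zero>\<^bsub>gr\<^esub> \<in> Q" and add: "\<And>f g. f \<in> Q \<Longrightarrow> g \<in> Q \<Longrightarrow> f \<oplus>\<^bsub>gr\<^esub> g \<in> Q"
    using additive_subgroup.zero_closed[OF Q.additive_subgroup_axioms]
      additive_subgroup.a_closed[OF Q.additive_subgroup_axioms] by auto
  note T = veronese_homogeneous_prime[OF Q.primeideal]
  have "V.cls_set ?T \<subseteq> P" if P: "primeideal P V.gr" and PT: "P \<subseteq> V.cls_set ?T" for P
  proof
    interpret P: primeideal P V.gr by (rule P)
    have zeroP: "\<zero>\<^bsub>V.gr\<^esub> \<in> P" and addP: "\<And>f g. f \<in> P \<Longrightarrow> g \<in> P \<Longrightarrow> f \<oplus>\<^bsub>V.gr\<^esub> g \<in> P"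
      using additive_subgroup.zero_closed[OF P.additive_subgroup_axioms]
        additive_subgroup.a_closed[OF P.additive_subgroup_axioms] by auto
    have forms: "V.form n x \<in> P" if x: "x \<in> ?T n" for n x
    proof -
      have xF: "x \<in> F (m * n)" and xQ: "form (m * n) x \<in> Q" using x by auto
      have xc: "x \<in> carrier R" using F_carrier[OF xF] .
      obtain z k where z: "z \<in> carrier gr - Q" "z \<otimes>\<^bsub>gr\<^esub> form (m * n) x [^]\<^bsub>gr\<^esub> (k::nat) = \<zero>\<^bsub>gr\<^esub>"
        using G.minimal_prime_power_annihilated[OF N Q xQ] by auto
      obtain c where c: "c \<in> rees" "z = cls c" using z(1) by (auto elim: gr_cases)
      \<comment> \<open>The multiplier \<open>z\<close> need not be homogeneous. One of its forms is
        outside \<open>Q\<close>, and since the power of the form of \<open>x\<close> is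
        homogeneous, that component alone kills it.\<close>
      have "\<exists>j. form j (c j) \<notin> Q"
        using cls_in_if_forms_in[OF c(1) zero add] z(1) c(2) by auto
      then obtain j where j: "form j (c j) \<notin> Q" ..
      note w = rees_F[OF c(1), of j]
      have wc: "c j \<in> carrier R" using F_carrier[OF w] .
      have "c j \<otimes> x [^] k \<in> F (Suc (j + m * n * k))"
        using z(2) cls_mult_form_zero_iff[OF c(1) F_pow[OF xF]] unfolding c(2) form_pow[OF xF] by simp
      \<comment> \<open>One extra order becomes \<open>m\<close> extra orders: the exponent is
        \<open>m\<close> times the successor of \<open>j + n * (k * m)\<close>, exactly what
        vanishing in that degree of \<open>V.gr\<close> requires.\<close>
      then have "(c j \<otimes> x [^] k) [^] m \<in> F (Suc (j + m * n * k) * m)" by (rule F_pow)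
      moreover have "(c j \<otimes> x [^] k) [^] m = c j [^] m \<otimes> x [^] (k * m)"
        using wc xc by (simp add: nat_pow_distrib nat_pow_pow)
      ultimately have van: "c j [^] m \<otimes> x [^] (k * m) \<in> F (m * Suc (j + n * (k * m)))"
        by (simp add: algebra_simps)
      have wm: "c j [^] m \<in> F (m * j)" using F_pow[OF w, of m] by (simp add: mult.commute)
      have xm: "x [^] (k * m) \<in> F (m * (n * (k * m)))" using F_pow[OF xF, of "k * m"] by (simp add: mult.assoc)
      have "V.form j (c j [^] m) \<otimes>\<^bsub>V.gr\<^esub> V.form n x [^]\<^bsub>V.gr\<^esub> (k * m) = \<zero>\<^bsub>V.gr\<^esub>"
        unfolding V.form_pow[OF xF] V.form_mult[OF wm xm]
        using V.form_zero_iff[of "c j [^] m \<otimes> x [^] (k * m)" "j + n * (k * m)"] van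
          V.F_mult[OF wm xm] by simp
      then have prod: "V.form j (c j [^] m) \<otimes>\<^bsub>V.gr\<^esub> V.form n x [^]\<^bsub>V.gr\<^esub> (k * m) \<in> P" using zeroP by simp
      \<comment> \<open>In \<open>gr\<close> the element \<open>c j [^] m\<close> has degree
        \<open>m * j\<close> and its form is the m-th power of a form outside \<open>Q\<close>; it
        is therefore outside the contraction, which contains \<open>P\<close>.\<close>
      have "V.form j (c j [^] m) \<notin> P"
      proof
        assume "V.form j (c j [^] m) \<in> P"
        then have "c j [^] m \<in> ?T j" using PT V.form_mem_cls_set_iff[OF T wm] by auto
        then have "form (j * m) (c j [^] m) \<in> Q" by (simp add: mult.commute)
        then have "form j (c j) [^]\<^bsub>gr\<^esub> m \<in> Q" using form_pow[OF w] by simp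
        then show False using Q.nat_pow_mem_imp_mem[OF form_closed[OF w]] j by simp
      qed
      moreover note fc = V.form_closed[OF xF]
      ultimately have "V.form n x [^]\<^bsub>V.gr\<^esub> (k * m) \<in> P"
        using P.I_prime[OF V.form_closed[OF wm] H.nat_pow_closed[OF fc] prod] by simp
      then show ?thesis by (rule P.nat_pow_mem_imp_mem[OF fc])
    qed
    fix f assume "f \<in> V.cls_set ?T"
    then obtain p where p: "p \<in> V.rees" "\<And>n. p n \<in> ?T n" "f = V.cls p" unfolding V.cls_set_def by auto
    show "f \<in> P" unfolding p(3) by (rule V.cls_in_if_forms_in[OF p(1) zeroP addP forms[OF p(2)]])
  qed
  then show ?thesis unfolding minimal_prime_def using V.primeideal_cls_set[OF T] by auto
qed

lemma veronese_zero_divisor_in_minimal_prime: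
  assumes N: "noetherian_ring gr" and S: "serre_condition 1 gr"
    and f: "f \<in> carrier V.gr" and g: "g \<in> carrier V.gr" "g \<noteq> \<zero>\<^bsub>V.gr\<^esub>" "f \<otimes>\<^bsub>V.gr\<^esub> g = \<zero>\<^bsub>V.gr\<^esub>"
  shows "\<exists>P. minimal_prime V.gr P \<and> f \<in> P"
proof -
  interpret G: cring gr by (rule cring_gr)
  obtain p where p: "p \<in> V.rees" "f = V.cls p" using f by (rule V.gr_cases)
  obtain q where q: "q \<in> V.rees" "g = V.cls q" using g(1) by (rule V.gr_cases)
  obtain k y where y: "y \<in> F (m * k)" "y \<notin> F (m * Suc k)"
      "V.cls p \<otimes>\<^bsub>V.gr\<^esub> V.form k y = \<zero>\<^bsub>V.gr\<^esub>"
    using V.zero_divisor_kills_form[OF p(1) q(1)] g p(2) q(2) by auto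
  \<comment> \<open>Some \<open>d\<close> exists because \<open>y\<close> is nonzero in degree
    \<open>k\<close> of \<open>V.gr\<close>, that is, outside \<open>F (m * Suc k)\<close>. The
    predecessor \<open>e\<close> of the least one is the order of \<open>y\<close>.\<close>
  define d where "d = (LEAST d. y \<notin> F d)"
  have d: "y \<notin> F d" "d \<le> m * Suc k"
    unfolding d_def by (rule LeastI[of "\<lambda>d. y \<notin> F d", OF y(2)], rule Least_le, rule y(2))
  have "m * k < d" using d(1) y(1) F_antimono[of d "m * k"] by (auto simp: not_le[symmetric])
  then obtain e where e: "d = Suc e" by (cases d) auto
  have ye: "y \<in> F e" using not_less_Least[of e "\<lambda>d. y \<notin> F d"] e unfolding d_def by auto
  have "form e y \<noteq> \<zero>\<^bsub>gr\<^esub>" using form_zero_iff[OF ye] d(1) e by simp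
  then obtain b where b: "b \<in> carrier gr" "annihilator gr (form e y) \<subseteq> annihilator gr b"
      "primeideal (annihilator gr b) gr"
    using G.prime_annihilator[OF N form_closed[OF ye]] by metis
  let ?Q = "annihilator gr b"
  let ?T = "\<lambda>n. {x \<in> F (m * n). form (m * n) x \<in> ?Q}"
  have min: "minimal_prime gr ?Q" by (rule G.serre_1_annihilator_minimal[OF S b(1,3)])
  have "p n \<in> ?T n" for n
  proof -
    have pn: "p n \<in> F (m * n)" using V.rees_F[OF p(1)] .
    have "p n \<otimes> y \<in> F (m * Suc (n + k))"
      using y(3) V.cls_mult_form_zero_iff[OF p(1) y(1)] by simp
    \<comment> \<open>The bound \<open>d \<le> m * Suc k\<close> is used here: vanishing of the
      product in \<open>V.gr\<close> is at least as strong as vanishing of the product of the forms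
      in \<open>gr\<close>.\<close>
    moreover have "Suc (m * n + e) \<le> m * Suc (n + k)" using d(2) e by (simp add: distrib_left)
    ultimately have "p n \<otimes> y \<in> F (Suc (m * n + e))" using F_antimono by auto
    then have "form (m * n) (p n) \<otimes>\<^bsub>gr\<^esub> form e y = \<zero>\<^bsub>gr\<^esub>"
      using form_mult[OF pn ye] form_zero_iff[OF F_mult[OF pn ye]] by simp
    then have "form (m * n) (p n) \<in> annihilator gr (form e y)"
      using form_closed[OF pn] by (simp add: annihilator_def)
    then show ?thesis using b(2) pn by auto
  qed
  then have "f \<in> V.cls_set ?T" unfolding V.cls_set_def using p by auto
  then show ?thesis using veronese_contraction_minimal[OF N min] by auto
qed

text \<open>A non-minimal prime is contained in none of the finitely many minimal primes, so it has
  an element outside all of them; zero divisors lie in minimal primes, hence that element is a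
  nonzerodivisor.\<close>

theorem serre_1_veronese:
  assumes N: "noetherian_ring gr"
    and N': "noetherian_ring (graded_quotient R (\<lambda>n. F (m * n)) (\<lambda>n. F (m * Suc n)))"
    and S: "serre_condition 1 gr"
  shows "serre_condition 1 (graded_quotient R (\<lambda>n. F (m * n)) (\<lambda>n. F (m * Suc n)))"
proof -
  interpret H: cring V.gr by (rule V.cring_gr)
  show ?thesis
  proof (rule H.serre_1I)
    fix P assume P: "primeideal P V.gr" "\<not> minimal_prime V.gr P"
    interpret P: primeideal P V.gr by (rule P(1))
    let ?S = "{p. minimal_prime V.gr p}"
    have "\<exists>x\<in>P. \<forall>p\<in>?S. x \<notin> p"
    proof (rule H.prime_avoidance[OF P.is_ideal H.finite_minimal_primes[OF N']])
      show "primeideal p V.gr" if "p \<in> ?S" for p using that by (simp add: minimal_prime_def)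
      show "p = q" if "p \<in> ?S" "q \<in> ?S" "p \<subseteq> q" for p q
        using that unfolding minimal_prime_def by simp
      show "\<not> P \<subseteq> p" if "p \<in> ?S" for p
      proof
        assume "P \<subseteq> p"
        then have "P = p" using that P(1) unfolding minimal_prime_def by simp
        then show False using that P(2) by simp
      qed
    qed
    then obtain x where x: "x \<in> P" "\<forall>p\<in>?S. x \<notin> p" ..
    have "\<forall>a\<in>carrier V.gr. x \<otimes>\<^bsub>V.gr\<^esub> a = \<zero>\<^bsub>V.gr\<^esub> \<longrightarrow> a = \<zero>\<^bsub>V.gr\<^esub>"
      using veronese_zero_divisor_in_minimal_prime[OF N S P.Icarr[OF x(1)]] x(2) by auto
    then show "\<exists>x\<in>P. \<forall>a\<in>carrier V.gr. x \<otimes>\<^bsub>V.gr\<^esub> a = \<zero>\<^bsub>V.gr\<^esub> \<longrightarrow> a = \<zero>\<^bsub>V.gr\<^esub>"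
      using x(1) by auto
  qed
qed

end

end

section \<open>Powers of an ideal, and finite generation of the associated graded ring\<close>

lemma ideal_pow_0: "ideal_pow R J 0 = carrier R"
  and ideal_pow_Suc: "ideal_pow R J (Suc n) = ideal_prod R (ideal_pow R J n) J"
  by (simp_all add: ideal_pow_def nat_pow_def ideals_set_def)

context cring
begin

context
  fixes J
  assumes J: "ideal J R"
begin

lemma ideal_ideal_pow: "ideal (ideal_pow R J n) R"
  by (induction n) (simp_all add: ideal_pow_0 ideal_pow_Suc oneideal ideal_prod_is_ideal J)

lemma ideal_pow_add: "ideal_prod R (ideal_pow R J i) (ideal_pow R J j) = ideal_pow R J (i + j)"
proof -
  interpret I: comm_monoid "ideals_set R" by (rule ideals_set_is_comm_monoid)
  have "J \<in> carrier (ideals_set R)" using J by (simp add: ideals_set_def)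
  then show ?thesis using I.nat_pow_mult[of J i j] by (simp add: ideal_pow_def ideals_set_def)
qed

lemma ideal_pow_pow: "ideal_pow R (ideal_pow R J i) j = ideal_pow R J (i * j)"
proof -
  interpret I: comm_monoid "ideals_set R" by (rule ideals_set_is_comm_monoid)
  have "J \<in> carrier (ideals_set R)" using J by (simp add: ideals_set_def)
  then show ?thesis using I.nat_pow_pow[of J i j] by (simp add: ideal_pow_def)
qed

lemma filtration_ideal_pow: "filtration R (ideal_pow R J)"
proof (rule filtration.intro[OF is_cring], rule filtration_axioms.intro)
  show "ideal (ideal_pow R J n) R" for n by (rule ideal_ideal_pow)
  show "ideal_pow R J 0 = carrier R" by (rule ideal_pow_0)
  show "ideal_pow R J (Suc n) \<subseteq> ideal_pow R J n" for n
    unfolding ideal_pow_Suc using ideal_prod_inter[OF ideal_ideal_pow J] by auto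
  show "a \<otimes> b \<in> ideal_pow R J (i + j)" if "a \<in> ideal_pow R J i" "b \<in> ideal_pow R J j" for a b i j
    using ideal_prod.prod[OF that, of R] by (simp add: ideal_pow_add)
qed

text \<open>The graded ring is generated over its degree-zero part, an image of \<open>R\<close>, by
  the degree-one forms of finitely many generators of \<open>J\<close>; the basis theorem for
  subrings applies.\<close>

lemma noetherian_assoc_graded:
  assumes N: "noetherian_ring R"
  shows "noetherian_ring (assoc_graded R J)"
proof -
  interpret filtration R "ideal_pow R J" by (rule filtration_ideal_pow)
  interpret G: cring gr by (rule cring_gr)
  let ?F = "ideal_pow R J"
  have F0: "x \<in> ?F 0" if "x \<in> carrier R" for x using that F_0 by simp
  have F1: "?F 1 = J"
    using ideal_prod_one[OF J] ideal_prod_commute[OF oneideal J] by (simp add: ideal_pow_0 ideal_pow_Suc)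
  let ?A = "form 0 ` carrier R"
  have hom: "form 0 \<in> ring_hom R gr"
    by (rule ring_hom_memI)
      (use F0 form_closed form_one form_mult[OF F0 F0] form_add[OF F0 F0] in simp_all)
  interpret h: ring_hom_ring R gr "form 0"
    by (rule ring_hom_ringI2[OF ring_axioms G.ring_axioms hom])
  have A: "subring ?A gr" by (rule h.img_is_subring[OF carrier_is_subring])
  have "ring_hom_ring R (gr\<lparr>carrier := ?A\<rparr>) (form 0)"
    by (rule ring_hom_ringI2[OF ring_axioms G.subring_is_ring[OF A]], rule ring_hom_memI) simp_all
  then have NA: "noetherian_ring (gr\<lparr>carrier := ?A\<rparr>)"
    by (rule ring_hom_ring.noetherian_image[OF _ N]) simp
  obtain S where S: "S \<subseteq> carrier R" "finite S" "J = Idl S"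
    using noetherian_ring.finetely_gen[OF N J] by auto
  have SJ: "S \<subseteq> ?F 1" using genideal_self[OF S(1)] S(3) F1 by simp
  have "noetherian_ring gr"
  proof (rule G.noetherian_finitely_generated[OF A NA])
    show "finite (form 1 ` S)" using S(2) by simp
    show "form 1 ` S \<subseteq> carrier gr" using SJ form_closed[of _ 1] by auto
    fix B assume B: "subring B gr" "?A \<subseteq> B" "form 1 ` S \<subseteq> B"
    have form0: "form 0 x \<in> B" if "x \<in> carrier R" for x using B(2) that by auto
    \<comment> \<open>This set is an ideal of \<open>R\<close> containing the generators of
      \<open>J\<close>, hence equals \<open>J\<close>: so \<open>B\<close> contains all forms of
      degree one and not just those of \<open>S\<close>.\<close>
    let ?K = "{x \<in> J. form 1 x \<in> B}"
    interpret J: ideal J R by (rule J)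
    have "ideal ?K R"
    proof (rule idealI[OF ring_axioms])
      have mult: "x \<otimes> a \<in> ?K" if "a \<in> ?K" "x \<in> carrier R" for a x
        using form_mult[of x 0 a 1] F0[OF that(2)] that J.I_l_closed[of a x] F1
          subringE(6)[OF B(1) form0[OF that(2)], of "form 1 a"] by simp
      then show "x \<otimes> a \<in> ?K" if "a \<in> ?K" "x \<in> carrier R" for a x using that by blast
      show "a \<otimes> x \<in> ?K" if "a \<in> ?K" "x \<in> carrier R" for a x
        using mult[OF that] m_comm[of a x] that J.Icarr by auto
      show "subgroup ?K (add_monoid R)"
      proof (rule add.subgroupI)
        show "?K \<subseteq> carrier R" using J.Icarr by auto
        have "\<zero> \<in> J" using F_zero[of 1] F1 by simp
        moreover have "form 1 \<zero> \<in> B" using form_zero_iff[OF F_zero] subringE(2)[OF B(1)] by simp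
        ultimately have "\<zero> \<in> ?K" by simp
        then show "?K \<noteq> {}" by blast
        show "\<ominus> a \<in> ?K" if "a \<in> ?K" for a
          using mult[OF that, of "\<ominus> \<one>"] that J.Icarr by (auto simp: l_minus)
        show "a \<oplus> b \<in> ?K" if "a \<in> ?K" "b \<in> ?K" for a b
          using form_add[of a 1 b] F_add[of a 1 b] F1 that
            subringE(7)[OF B(1), of "form 1 a" "form 1 b"] by simp
      qed
    qed
    moreover have "S \<subseteq> ?K" using B(3) SJ F1 by auto
    ultimately have "J \<subseteq> ?K" using genideal_minimal S(3) by simp
    then have form1: "form 1 x \<in> B" if "x \<in> J" for x using that by auto
    have forms: "form n x \<in> B" if "x \<in> ?F n" for n x
      using that
    proof (induction n arbitrary: x)
      case 0
      then show ?case using form0 F_carrier by simp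
    next
      \<comment> \<open>A second induction runs over the inductive definition of the ideal product:
        products of a form of degree \<open>n\<close> with one of degree one, and sums of
        such.\<close>
      case (Suc n)
      from Suc.prems have "x \<in> ideal_prod R (?F n) J" by (simp add: ideal_pow_Suc)
      then show ?case
      proof (induction x rule: ideal_prod.induct)
        case (prod i j)
        then show ?case
          using form_mult[of i n j 1] F1 subringE(6)[OF B(1) Suc.IH[OF prod(1)] form1[OF prod(2)]] by simp
      next
        case (sum s t)
        then show ?case
          using form_add[of s "Suc n" t] subringE(7)[OF B(1) sum(3,4)] by (simp add: ideal_pow_Suc)
      qed
    qed
    show "carrier gr \<subseteq> B"
    proof
      fix f assume "f \<in> carrier gr"
      then obtain p where p: "p \<in> rees" "f = cls p" by (rule gr_cases)
      show "f \<in> B"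
        unfolding p(2)
        by (rule cls_in_if_forms_in[OF p(1) subringE(2)[OF B(1)] subringE(7)[OF B(1)] forms[OF rees_F[OF p(1)]]])
    qed
  qed
  then show ?thesis by (simp add: assoc_graded_def)
qed

end

theorem serre_1_assoc_graded_ideal_pow:
  assumes N: "noetherian_ring R" and I: "ideal I R" and m: "1 \<le> m"
    and S: "serre_condition 1 (assoc_graded R I)"
  shows "serre_condition 1 (assoc_graded R (ideal_pow R I m))"
proof -
  interpret filtration R "ideal_pow R I" by (rule filtration_ideal_pow[OF I])
  \<comment> \<open>The identity (I^m)^n = I^(mn) makes the two graded rings literally equal, so no
    isomorphism has to be transported through S_1.\<close>
  have eq: "assoc_graded R (ideal_pow R I m)
      = graded_quotient R (\<lambda>n. ideal_pow R I (m * n)) (\<lambda>n. ideal_pow R I (m * Suc n))"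
    unfolding assoc_graded_def ideal_pow_pow[OF I] ..
  have "noetherian_ring gr" "serre_condition 1 gr"
    using noetherian_assoc_graded[OF I N] S by (simp_all add: assoc_graded_def)
  moreover have "noetherian_ring (assoc_graded R (ideal_pow R I m))"
    by (rule noetherian_assoc_graded[OF ideal_ideal_pow[OF I] N])
  ultimately show ?thesis unfolding eq using serre_1_veronese[OF m] by blast
qed

end

theorem corollary3p6:
  fixes R :: "('a, 'b) ring_scheme" and M I :: "'a set" and m :: nat
  assumes "noetherian_local_ring R M"
    and "quasi_unmixed R M"
    and "equimultiple R M I"
    and "serre_condition 1 (assoc_graded R I)"
    and "1 \<le> m"
  shows "serre_condition 1 (assoc_graded R (ideal_pow R I m))"
proof (rule cring.serre_1_assoc_graded_ideal_pow)
  show "cring R" "noetherian_ring R" using assms(1) by (simp_all add: noetherian_local_ring_def)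
  show "ideal I R" using assms(3) by (simp add: equimultiple_def)
qed (use assms in simp_all)

end
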